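(* It is possible to construct a triple-well scenario with $TC(y,z)=4/9$ such that modifying the graph only slightly and arbitrarily far from the wells yields $TC(y,z)=1$. Precisely: for every $R\ge 1$ there exist finite connected graphs $G$ and $G'$, where $G'$ is obtained from $G$ by attaching one new vertex by a single new edge, and three vertices $x,y,z$ of $G$ such that the balls of radius $R$ around $\{x,y,z\}$ in $G$ and in $G'$ coincide, and for the simple triple-well potential $W=\chi_{\{x,y,z\}}$ one has $TC(y,z)=4/9$ in $G$ while $TC(y,z)=1$ in $G'$. Hence the tunneling coefficient is not determined by any fixed neighborhood of the wells.
   Context: For a finite connected graph $G=(X,E)$ with degrees $d_v$, the symmetrized Laplacian $\Delta$ has $\Delta(v,v)=1$, $\Delta(v,w)=-1/\sqrt{d_vd_w}$ if $vw\in E$, $0$ otherwise; $H=\Delta-QW$ with $W$ a diagonal matrix and $Q$ real. Starting from vertex $u$, the state is $\varphi_t=e^{itH}\chi_u$ ($\chi_u$ the indicator of $u$), depending on $Q$, and $TC(u,v)=\liminf_{Q\to\infty}\sup_{t\in[0,\infty)}|\varphi_t(v)|^2$. *)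

theory Defs
  imports "HOL-Analysis.Analysis"
begin

definition graph :: "nat set \<Rightarrow> (nat \<Rightarrow> nat \<Rightarrow> bool) \<Rightarrow> bool" where
  "graph V E \<longleftrightarrow> finite V \<and> V \<noteq> {} \<and> (\<forall>a b. E a b \<longrightarrow> a \<in> V \<and> b \<in> V)
     \<and> (\<forall>a b. E a b \<longrightarrow> E b a) \<and> (\<forall>a. \<not> E a a)"

definition connected_graph :: "nat set \<Rightarrow> (nat \<Rightarrow> nat \<Rightarrow> bool) \<Rightarrow> bool" where
  "connected_graph V E \<longleftrightarrow> graph V E \<and> (\<forall>a\<in>V. \<forall>b\<in>V. E\<^sup>*\<^sup>* a b)"

definition deg :: "nat set \<Rightarrow> (nat \<Rightarrow> nat \<Rightarrow> bool) \<Rightarrow> nat \<Rightarrow> nat" where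
  "deg V E v = card {w \<in> V. E v w}"

definition lap :: "nat set \<Rightarrow> (nat \<Rightarrow> nat \<Rightarrow> bool) \<Rightarrow> nat \<Rightarrow> nat \<Rightarrow> real" where
  "lap V E v w = (if v = w then 1
     else if E v w then - 1 / sqrt (real (deg V E v) * real (deg V E w)) else 0)"

definition ham :: "nat set \<Rightarrow> (nat \<Rightarrow> nat \<Rightarrow> bool) \<Rightarrow> nat set \<Rightarrow> real \<Rightarrow> nat \<Rightarrow> nat \<Rightarrow> complex" where
  "ham V E Wl Q v w = complex_of_real (lap V E v w - Q * (if v = w \<and> v \<in> Wl then 1 else 0))"

fun mat_pow :: "nat set \<Rightarrow> (nat \<Rightarrow> nat \<Rightarrow> complex) \<Rightarrow> nat \<Rightarrow> nat \<Rightarrow> nat \<Rightarrow> complex" where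
  "mat_pow V A 0 = (\<lambda>v w. if v = w then 1 else 0)"
| "mat_pow V A (Suc k) = (\<lambda>v w. \<Sum>u\<in>V. A v u * mat_pow V A k u w)"

definition mat_exp :: "nat set \<Rightarrow> (nat \<Rightarrow> nat \<Rightarrow> complex) \<Rightarrow> nat \<Rightarrow> nat \<Rightarrow> complex" where
  "mat_exp V A v w = (\<Sum>k. mat_pow V A k v w / of_nat (fact k))"

definition evol :: "nat set \<Rightarrow> (nat \<Rightarrow> nat \<Rightarrow> bool) \<Rightarrow> nat set \<Rightarrow> real \<Rightarrow> real \<Rightarrow> nat \<Rightarrow> nat \<Rightarrow> complex" where
  "evol V E Wl Q t u v = mat_exp V (\<lambda>a b. \<i> * complex_of_real t * ham V E Wl Q a b) v u"

definition TC :: "nat set \<Rightarrow> (nat \<Rightarrow> nat \<Rightarrow> bool) \<Rightarrow> nat set \<Rightarrow> nat \<Rightarrow> nat \<Rightarrow> ereal" where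
  "TC V E Wl u v = Liminf at_top (\<lambda>Q::real. SUP t\<in>{0::real..}. ereal ((cmod (evol V E Wl Q t u v))\<^sup>2))"

definition gball :: "nat set \<Rightarrow> (nat \<Rightarrow> nat \<Rightarrow> bool) \<Rightarrow> nat \<Rightarrow> nat set \<Rightarrow> nat set" where
  "gball V E R S = {v \<in> V. \<exists>s\<in>S. \<exists>n\<le>R. (E ^^ n) s v}"

end

theory Submission
  imports Defs
begin

text \<open>
  Take a triangle with a long path attached to each corner, and put one well on each path, at
  equal depth. For a state supported on the wells, the evolution is asymptotically governed by
  the eigenvectors of \<^term>\<open>ham\<close> with eigenvalue at most \<open>1 - Q\<close>: since the Laplacian is
  nonnegative, such eigenvectors carry mass at least \<open>1 - 1/Q\<close> on the wells.

  In \<open>G\<close> the permutations of the legs act on the wells, so the amplitude from \<open>y\<close> to \<open>z\<close> is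
  \<open>(\<langle>s, U s\<rangle> - \<langle>o, U o\<rangle>) / 3\<close> with \<open>s\<close> the normalized indicator of the wells and
  \<open>o = (y - z) / \<surd>2\<close>. Both terms are asymptotically phases; the frequencies differ because a
  ground state has no zeros, whereas odd states vanish at \<open>x\<close>. Hence the supremum tends to
  \<open>(2/3)\<^sup>2\<close>.

  In \<open>G'\<close> the leg of \<open>x\<close> is one vertex longer. This changes the local energy at \<open>x\<close> by
  an amount that is tiny, but still large compared with the coupling between the wells, which are much
  further from each other than from the ends of the legs. The ground state therefore leaves \<open>x\<close>
  and tends to \<open>e = (y + z) / \<surd>2\<close>, the amplitude is \<open>(\<langle>e, U e\<rangle> - \<langle>o, U o\<rangle>) / 2\<close>, and the
  supremum tends to 1.
\<close>

section \<open>Exponentials of real symmetric matrices\<close>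

lemma mat_pow_scale:
  "mat_pow V (\<lambda>a b. c * A a b) k v w = c ^ k * mat_pow V A k v w"
  by (induction k arbitrary: v) (simp_all add: sum_distrib_left mult_ac)

lemma norm_mat_pow_le:
  assumes "finite V" "\<And>a b. a \<in> V \<Longrightarrow> b \<in> V \<Longrightarrow> cmod (A a b) \<le> K" "0 \<le> K" "v \<in> V"
  shows "cmod (mat_pow V A k v w) \<le> (K * card V) ^ k"
  using assms(4)
proof (induction k arbitrary: v)
  case (Suc k)
  have "cmod (mat_pow V A (Suc k) v w) \<le> (\<Sum>u\<in>V. cmod (A v u * mat_pow V A k u w))"
    by (simp add: norm_sum)
  also have "\<dots> \<le> (\<Sum>u\<in>V. K * (K * card V) ^ k)"
    using Suc assms by (intro sum_mono) (auto simp: norm_mult intro!: mult_mono)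
  finally show ?case by (simp add: mult_ac)
qed simp

lemma matrix_entries_bounded:
  fixes A :: "nat \<Rightarrow> nat \<Rightarrow> complex"
  assumes "finite V"
  obtains K where "0 \<le> K" "\<And>a b. a \<in> V \<Longrightarrow> b \<in> V \<Longrightarrow> cmod (A a b) \<le> K"
proof
  let ?K = "\<Sum>p\<in>V \<times> V. cmod (case p of (a, b) \<Rightarrow> A a b)"
  show "0 \<le> ?K" by (simp add: sum_nonneg)
  show "cmod (A a b) \<le> ?K" if "a \<in> V" "b \<in> V" for a b
    using member_le_sum[of "(a, b)" "V \<times> V" "\<lambda>p. cmod (case p of (a, b) \<Rightarrow> A a b)"] that assms
    by auto
qed

text \<open>The extra variable \<open>x\<close> turns the exponential series into a power series
  that converges everywhere, so that termwise differentiation applies later. The comparison is with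
  the scalar series of \<open>exp (K * card V * cmod x)\<close>.\<close>

lemma mat_pow_power_series_summable:
  fixes x :: complex
  assumes "finite V" "v \<in> V"
  shows "summable (\<lambda>k. (mat_pow V A k v w / of_nat (fact k)) * x ^ k)"
proof -
  obtain K where K: "0 \<le> K" "\<And>a b. a \<in> V \<Longrightarrow> b \<in> V \<Longrightarrow> cmod (A a b) \<le> K"
    using matrix_entries_bounded assms(1) by blast
  show ?thesis
  proof (rule summable_comparison_test)
    show "summable (\<lambda>k. inverse (fact k) * (K * card V * cmod x) ^ k)"
      by (rule summable_exp)
    have "cmod ((mat_pow V A k v w / of_nat (fact k)) * x ^ k)
        \<le> inverse (fact k) * (K * card V * cmod x) ^ k" for k
      using mult_right_mono[OF norm_mat_pow_le[OF assms(1) K(2) K(1) assms(2)],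
          where c = "cmod x ^ k / fact k"]
      by (simp add: norm_mult norm_divide norm_power power_mult_distrib divide_inverse mult_ac
          norm_inverse)
    then show "\<exists>N. \<forall>k\<ge>N. norm ((mat_pow V A k v w / of_nat (fact k)) * x ^ k)
        \<le> inverse (fact k) * (K * card V * cmod x) ^ k"
      by blast
  qed
qed

lemma mat_pow_summable:
  assumes "finite V" "v \<in> V"
  shows "summable (\<lambda>k. mat_pow V A k v w / of_nat (fact k))"
  using mat_pow_power_series_summable[OF assms, where x = 1] by simp

text \<open>Each power of \<open>A\<close> acts on \<open>f\<close> as the same power of
  \<open>c\<close>, so the series sums to the scalar exponential.\<close>

lemma mat_exp_eigenvector:
  assumes V: "finite V" and v: "v \<in> V"
    and eig: "\<And>v. v \<in> V \<Longrightarrow> (\<Sum>w\<in>V. A v w * f w) = c * f v"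
  shows "(\<Sum>w\<in>V. mat_exp V A v w * f w) = exp c * f v"
proof -
  have pow: "(\<Sum>w\<in>V. mat_pow V A k v w * f w) = c ^ k * f v" if "v \<in> V" for k v
    using that
  proof (induction k arbitrary: v)
    case 0
    then show ?case using V by (simp add: if_distrib[of "\<lambda>x. x * _"] cong: if_cong)
  next
    case (Suc k)
    have "(\<Sum>w\<in>V. mat_pow V A (Suc k) v w * f w)
        = (\<Sum>u\<in>V. A v u * (\<Sum>w\<in>V. mat_pow V A k u w * f w))"
      by (simp add: sum_distrib_left sum_distrib_right mult.assoc) (rule sum.swap)
    also have "\<dots> = c ^ k * (\<Sum>u\<in>V. A v u * f u)"
      using Suc.IH by (simp add: sum_distrib_left mult_ac)
    finally show ?case using eig[OF Suc.prems] by (simp add: mult_ac)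
  qed
  have "(\<Sum>w\<in>V. mat_exp V A v w * f w)
      = (\<Sum>k. \<Sum>w\<in>V. mat_pow V A k v w / of_nat (fact k) * f w)"
    unfolding mat_exp_def
    by (simp only: suminf_sum[OF summable_mult2[OF mat_pow_summable[OF V v]]]
        suminf_mult2[OF mat_pow_summable[OF V v], symmetric])
  also have "\<dots> = (\<Sum>k. (c ^ k /\<^sub>R fact k) * f v)"
  proof (rule arg_cong[where f = suminf], rule ext)
    fix k
    have "(\<Sum>w\<in>V. mat_pow V A k v w / of_nat (fact k) * f w)
        = (\<Sum>w\<in>V. mat_pow V A k v w * f w) / of_nat (fact k)"
      by (simp add: sum_divide_distrib)
    then show "(\<Sum>w\<in>V. mat_pow V A k v w / of_nat (fact k) * f w) = (c ^ k /\<^sub>R fact k) * f v"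
      unfolding pow[OF v] by (simp add: scaleR_conv_of_real divide_inverse mult_ac)
  qed
  also have "\<dots> = exp c * f v"
    by (simp add: exp_def suminf_mult2[OF summable_exp_generic])
  finally show ?thesis .
qed

lemma mat_exp_invariant:
  assumes \<tau>: "bij_betw \<tau> V V" and vw: "v \<in> V" "w \<in> V"
    and inv: "\<And>a b. a \<in> V \<Longrightarrow> b \<in> V \<Longrightarrow> A (\<tau> a) (\<tau> b) = A a b"
  shows "mat_exp V A (\<tau> v) (\<tau> w) = mat_exp V A v w"
proof -
  have "mat_pow V A k (\<tau> v) (\<tau> w) = mat_pow V A k v w" if "v \<in> V" for k v
    using that
  proof (induction k arbitrary: v)
    case 0
    then show ?case using vw(2) \<tau> by (auto simp: bij_betw_def inj_on_def)
  next
    case (Suc k)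
    have "mat_pow V A (Suc k) (\<tau> v) (\<tau> w)
        = (\<Sum>u\<in>V. A (\<tau> v) (\<tau> u) * mat_pow V A k (\<tau> u) (\<tau> w))"
      using sum.reindex_bij_betw[OF \<tau>, symmetric] by simp
    then show ?case using Suc inv by simp
  qed
  then show ?thesis using vw by (simp add: mat_exp_def)
qed

section \<open>Time evolution and unitarity\<close>

lemma mat_exp_zero: "mat_exp V (\<lambda>_ _. 0) v w = (if v = w then 1 else 0)"
proof -
  have "mat_pow V (\<lambda>_ _. 0) k v w / of_nat (fact k) = (if v = w then 1 else 0) * 0 ^ k" for k
    by (cases k) auto
  then show ?thesis by (simp add: mat_exp_def)
qed

lemma mat_exp_has_vector_derivative:
  fixes t :: real
  assumes V: "finite V" and v: "v \<in> V"
  shows "((\<lambda>t. mat_exp V (\<lambda>a b. of_real t * A a b) v w) has_vector_derivative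
      (\<Sum>u\<in>V. A v u * mat_exp V (\<lambda>a b. of_real t * A a b) u w)) (at t)"
proof -
  let ?c = "\<lambda>v k. mat_pow V A k v w / of_nat (fact k)"
  have series: "mat_exp V (\<lambda>a b. z * A a b) v w = (\<Sum>k. ?c v k * z ^ k)" for v z
    by (simp add: mat_exp_def mat_pow_scale mult.commute)
  \<comment> \<open>Differentiation cancels one factor of the factorial and leaves the power
    \<open>Suc k\<close> over \<open>fact k\<close>. Splitting off the leftmost \<open>A\<close>
    gives the coefficients of \<open>A\<close> times the original series.\<close>
  have diffs: "diffs (?c v) k * z ^ k = (\<Sum>u\<in>V. A v u * (?c u k * z ^ k))" for k z
  proof -
    have "diffs (?c v) k = mat_pow V A (Suc k) v w / of_nat (fact k)"
      by (simp add: diffs_def field_simps del: mat_pow.simps of_nat_Suc)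
    then show ?thesis
      by (simp add: sum_divide_distrib sum_distrib_left sum_distrib_right mult_ac)
  qed
  have "((\<lambda>z. \<Sum>k. ?c v k * z ^ k) has_field_derivative (\<Sum>k. diffs (?c v) k * z ^ k)) (at z)" for z
    by (rule termdiffs_strong_converges_everywhere) (rule mat_pow_power_series_summable[OF V v])
  moreover have "(\<Sum>k. diffs (?c v) k * z ^ k) = (\<Sum>u\<in>V. A v u * (\<Sum>k. ?c u k * z ^ k))" for z
    unfolding diffs
    by (simp only: suminf_sum[OF summable_mult[OF mat_pow_power_series_summable[OF V]]]
        suminf_mult[OF mat_pow_power_series_summable[OF V]] cong: sum.cong)
  ultimately have "((\<lambda>z. mat_exp V (\<lambda>a b. z * A a b) v w) has_field_derivative
      (\<Sum>u\<in>V. A v u * mat_exp V (\<lambda>a b. z * A a b) u w)) (at z)" for z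
    by (simp add: series)
  from has_vector_derivative_real_field[OF this[of "of_real t"]] show ?thesis .
qed

text \<open>The squared norm \<open>N\<close> of the evolved vector has derivative zero, because
  \<i> times a real symmetric matrix is anti-Hermitian. At time 0 it is the squared norm of
  \<open>b\<close>.\<close>

lemma mat_exp_unitary:
  fixes h :: "nat \<Rightarrow> nat \<Rightarrow> real" and b :: "nat \<Rightarrow> complex"
  assumes V: "finite V" and sym: "\<And>v w. v \<in> V \<Longrightarrow> w \<in> V \<Longrightarrow> h v w = h w v"
  shows "(\<Sum>v\<in>V. (cmod (\<Sum>w\<in>V. mat_exp V (\<lambda>a b. \<i> * of_real t * of_real (h a b)) v w * b w))\<^sup>2)
       = (\<Sum>v\<in>V. (cmod (b v))\<^sup>2)"
proof -
  define A where "A = (\<lambda>a b. \<i> * complex_of_real (h a b))"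
  define g where "g = (\<lambda>t v. \<Sum>w\<in>V. mat_exp V (\<lambda>a b. of_real t * A a b) v w * b w)"
  define N where "N = (\<lambda>t. \<Sum>v\<in>V. g t v * cnj (g t v))"
  have g': "((\<lambda>t. g t v) has_vector_derivative (\<Sum>u\<in>V. A v u * g t u)) (at t)" if "v \<in> V" for v t
  proof -
    have "((\<lambda>t. g t v) has_vector_derivative
        (\<Sum>w\<in>V. (\<Sum>u\<in>V. A v u * mat_exp V (\<lambda>a b. of_real t * A a b) u w) * b w)) (at t)"
      unfolding g_def
      by (intro has_vector_derivative_sum has_vector_derivative_mult_left
          mat_exp_has_vector_derivative V that)
    moreover have "(\<Sum>w\<in>V. (\<Sum>u\<in>V. A v u * mat_exp V (\<lambda>a b. of_real t * A a b) u w) * b w)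
        = (\<Sum>u\<in>V. A v u * g t u)"
      unfolding g_def sum_distrib_left sum_distrib_right mult.assoc by (rule sum.swap)
    ultimately show ?thesis by simp
  qed
  have "(N has_vector_derivative 0) (at t)" for t
  proof -
    have "(N has_vector_derivative
        (\<Sum>v\<in>V. g t v * cnj (\<Sum>u\<in>V. A v u * g t u) + (\<Sum>u\<in>V. A v u * g t u) * cnj (g t v))) (at t)"
      unfolding N_def
      by (intro has_vector_derivative_sum has_vector_derivative_mult has_vector_derivative_cnj g')
    \<comment> \<open>Conjugation turns \<i> into -\<i>. After exchanging the summations, symmetry
      of \<open>h\<close> makes the two halves of the derivative cancel.\<close>
    moreover have "(\<Sum>v\<in>V. g t v * cnj (\<Sum>u\<in>V. A v u * g t u)) 
        = - (\<Sum>u\<in>V. \<Sum>v\<in>V. \<i> * of_real (h v u) * g t v * cnj (g t u))"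
      by (subst sum.swap) (simp add: A_def sum_distrib_left sum_negf mult_ac)
    moreover have "(\<Sum>u\<in>V. \<Sum>v\<in>V. \<i> * of_real (h v u) * g t v * cnj (g t u))
        = (\<Sum>u\<in>V. (\<Sum>v\<in>V. A u v * g t v) * cnj (g t u))"
      using sym by (simp add: A_def sum_distrib_right)
    ultimately show ?thesis by (simp add: sum.distrib)
  qed
  then obtain c where c: "\<And>t. N t = c"
    using has_vector_derivative_zero_constant[of UNIV N] by (auto simp: has_vector_derivative_at_within)
  have "N t = N 0" by (simp add: c)
  moreover have "g 0 v = b v" if "v \<in> V" for v
    using that V by (simp add: g_def mat_exp_zero if_distrib[of "\<lambda>x. x * _"] cong: if_cong)
  ultimately have "N t = (\<Sum>v\<in>V. b v * cnj (b v))" by (simp add: N_def)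
  then have "complex_of_real (\<Sum>v\<in>V. (cmod (g t v))\<^sup>2) = complex_of_real (\<Sum>v\<in>V. (cmod (b v))\<^sup>2)"
    by (simp add: N_def flip: complex_norm_square)
  then show ?thesis
    unfolding of_real_eq_iff by (simp add: g_def A_def mult_ac)
qed

text \<open>Cauchy-Schwarz, where unitarity gives the evolved \<open>g\<close> the norm of
  \<open>g\<close>.\<close>

lemma mat_exp_matrix_element_le:
  fixes h :: "nat \<Rightarrow> nat \<Rightarrow> real" and f g :: "nat \<Rightarrow> real"
  assumes V: "finite V" and sym: "\<And>v w. v \<in> V \<Longrightarrow> w \<in> V \<Longrightarrow> h v w = h w v"
  shows "cmod (\<Sum>v\<in>V. \<Sum>w\<in>V. of_real (f v) *
      mat_exp V (\<lambda>a b. \<i> * of_real t * of_real (h a b)) v w * of_real (g w))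
    \<le> sqrt (\<Sum>v\<in>V. (f v)\<^sup>2) * sqrt (\<Sum>v\<in>V. (g v)\<^sup>2)"
proof -
  let ?G = "\<lambda>v. \<Sum>w\<in>V. mat_exp V (\<lambda>a b. \<i> * of_real t * of_real (h a b)) v w * of_real (g w)"
  have "cmod (\<Sum>v\<in>V. \<Sum>w\<in>V. of_real (f v) *
      mat_exp V (\<lambda>a b. \<i> * of_real t * of_real (h a b)) v w * of_real (g w))
      = cmod (\<Sum>v\<in>V. of_real (f v) * ?G v)"
    by (simp add: sum_distrib_left mult.assoc)
  also have "\<dots> \<le> (\<Sum>v\<in>V. \<bar>f v\<bar> * \<bar>cmod (?G v)\<bar>)"
    by (rule order_trans[OF norm_sum]) (simp add: norm_mult)
  also have "\<dots> \<le> L2_set f V * L2_set (\<lambda>v. cmod (?G v)) V"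
    by (rule L2_set_mult_ineq)
  also have "L2_set (\<lambda>v. cmod (?G v)) V = sqrt (\<Sum>v\<in>V. (g v)\<^sup>2)"
    using mat_exp_unitary[OF V sym, where t = t and b = "\<lambda>v. of_real (g v)"] by (simp add: L2_set_def)
  finally show ?thesis by (simp add: L2_set_def)
qed

text \<open>Write \<phi> as \<open>a * \<psi>\<close> plus a remainder \<eta>. The first part only
  acquires a phase and contributes \<open>a\<^sup>2 * cis (t * l)\<close>; the remainder contributes
  at most its norm \<open>sqrt (1 - a\<^sup>2)\<close>. One eigenvector thus controls the amplitude
  uniformly in \<open>t\<close>.\<close>

lemma return_amplitude_near_phase:
  fixes h :: "nat \<Rightarrow> nat \<Rightarrow> real" and \<phi> \<psi> :: "nat \<Rightarrow> real"
  assumes V: "finite V" and sym: "\<And>v w. v \<in> V \<Longrightarrow> w \<in> V \<Longrightarrow> h v w = h w v"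
    and eig: "\<And>v. v \<in> V \<Longrightarrow> (\<Sum>w\<in>V. h v w * \<psi> w) = l * \<psi> v"
    and \<phi>: "(\<Sum>v\<in>V. (\<phi> v)\<^sup>2) = 1" and \<psi>: "(\<Sum>v\<in>V. (\<psi> v)\<^sup>2) = 1"
    and overlap: "(\<Sum>v\<in>V. \<phi> v * \<psi> v)\<^sup>2 \<ge> 1 - e"
  shows "cmod ((\<Sum>v\<in>V. \<Sum>w\<in>V. of_real (\<phi> v) *
      mat_exp V (\<lambda>a b. \<i> * of_real t * of_real (h a b)) v w * of_real (\<phi> w)) - cis (t * l))
    \<le> e + sqrt e"
proof -
  define a where "a = (\<Sum>v\<in>V. \<phi> v * \<psi> v)"
  define \<eta> where "\<eta> = (\<lambda>v. \<phi> v - a * \<psi> v)"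
  define U where "U = mat_exp V (\<lambda>a b. \<i> * of_real t * of_real (h a b))"
  have "(\<Sum>w\<in>V. \<i> * of_real t * of_real (h v w) * complex_of_real (\<psi> w))
      = \<i> * of_real (t * l) * of_real (\<psi> v)" if "v \<in> V" for v
  proof -
    have "(\<Sum>w\<in>V. \<i> * of_real t * of_real (h v w) * complex_of_real (\<psi> w))
        = \<i> * of_real t * of_real (\<Sum>w\<in>V. h v w * \<psi> w)"
      by (simp add: sum_distrib_left mult.assoc)
    then show ?thesis by (simp add: eig[OF that])
  qed
  then have U\<psi>: "(\<Sum>w\<in>V. U v w * of_real (\<psi> w)) = cis (t * l) * of_real (\<psi> v)" if "v \<in> V" for v
    unfolding U_def cis_conv_exp
    by (intro mat_exp_eigenvector V that) auto
  have norm\<eta>: "(\<Sum>v\<in>V. (\<eta> v)\<^sup>2) = 1 - a\<^sup>2"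
  proof -
    have "(\<Sum>v\<in>V. (\<eta> v)\<^sup>2)
        = (\<Sum>v\<in>V. (\<phi> v)\<^sup>2) - 2 * a * (\<Sum>v\<in>V. \<phi> v * \<psi> v) + a\<^sup>2 * (\<Sum>v\<in>V. (\<psi> v)\<^sup>2)"
      by (simp add: \<eta>_def power2_eq_square algebra_simps sum.distrib sum_subtractf sum_distrib_left)
    then show ?thesis by (simp add: \<phi> \<psi> flip: a_def) (simp add: power2_eq_square)
  qed
  have a1: "0 \<le> 1 - a\<^sup>2" unfolding norm\<eta>[symmetric] by (simp add: sum_nonneg)
  \<comment> \<open>Only the right-hand \<phi> is decomposed, so pairing the left-hand one with
    \<psi> produces the overlap \<open>a\<close> once more.\<close>
  have "(\<Sum>v\<in>V. \<Sum>w\<in>V. of_real (\<phi> v) * U v w * of_real (\<phi> w))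
      = of_real a * (\<Sum>v\<in>V. of_real (\<phi> v) * (\<Sum>w\<in>V. U v w * of_real (\<psi> w)))
        + (\<Sum>v\<in>V. \<Sum>w\<in>V. of_real (\<phi> v) * U v w * of_real (\<eta> w))"
    by (simp add: \<eta>_def algebra_simps sum.distrib sum_subtractf sum_distrib_left)
  also have "(\<Sum>v\<in>V. of_real (\<phi> v) * (\<Sum>w\<in>V. U v w * of_real (\<psi> w))) = cis (t * l) * of_real a"
    unfolding a_def of_real_sum sum_distrib_left[of "cis _"]
    by (intro sum.cong refl) (simp only: U\<psi>, simp)
  finally have "(\<Sum>v\<in>V. \<Sum>w\<in>V. of_real (\<phi> v) * U v w * of_real (\<phi> w)) - cis (t * l)
      = (\<Sum>v\<in>V. \<Sum>w\<in>V. of_real (\<phi> v) * U v w * of_real (\<eta> w)) - of_real (1 - a\<^sup>2) * cis (t * l)"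
    by (simp add: algebra_simps power2_eq_square)
  then have "cmod ((\<Sum>v\<in>V. \<Sum>w\<in>V. of_real (\<phi> v) * U v w * of_real (\<phi> w)) - cis (t * l))
      \<le> cmod (\<Sum>v\<in>V. \<Sum>w\<in>V. of_real (\<phi> v) * U v w * of_real (\<eta> w)) + (1 - a\<^sup>2)"
    using norm_triangle_ineq4[of "\<Sum>v\<in>V. \<Sum>w\<in>V. of_real (\<phi> v) * U v w * of_real (\<eta> w)"
        "of_real (1 - a\<^sup>2) * cis (t * l)"] a1
    by (simp add: norm_mult del: of_real_diff)
  also have "\<dots> \<le> sqrt (1 - a\<^sup>2) + (1 - a\<^sup>2)"
    using mat_exp_matrix_element_le[OF V sym, where f = \<phi> and g = \<eta> and t = t] by (simp add: U_def \<phi> norm\<eta>)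
  also have "\<dots> \<le> sqrt e + e"
    using overlap by (intro add_mono real_sqrt_le_mono) (simp_all add: a_def)
  finally show ?thesis by (simp add: U_def)
qed

section \<open>Minimizers of quadratic forms\<close>

definition qform :: "nat set \<Rightarrow> (nat \<Rightarrow> nat \<Rightarrow> real) \<Rightarrow> (nat \<Rightarrow> real) \<Rightarrow> real" where
  "qform V h f = (\<Sum>v\<in>V. \<Sum>w\<in>V. f v * h v w * f w)"

text \<open>The constraint selects a symmetry sector: the identity with \<open>s = 1\<close> gives
  the unrestricted minimum, a reflection with \<open>s = - 1\<close> the minimum over odd functions.
  Functions are set to 0 outside \<open>V\<close> and lie in [-1, 1] on it, so they form a compact
  product set by Tychonoff.\<close>

lemma qform_minimizer_exists:
  fixes h :: "nat \<Rightarrow> nat \<Rightarrow> real"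
  assumes V: "finite V" and \<tau>: "\<And>v. v \<in> V \<Longrightarrow> \<tau> v \<in> V"
    and f0: "(\<Sum>v\<in>V. (f0 v)\<^sup>2) = 1" "\<And>v. v \<in> V \<Longrightarrow> f0 (\<tau> v) = s * f0 v"
  obtains f l where "(\<Sum>v\<in>V. (f v)\<^sup>2) = 1" "\<And>v. v \<in> V \<Longrightarrow> f (\<tau> v) = s * f v" "qform V h f = l"
    "\<And>g. (\<And>v. v \<in> V \<Longrightarrow> g (\<tau> v) = s * g v) \<Longrightarrow> l * (\<Sum>v\<in>V. (g v)\<^sup>2) \<le> qform V h g"
proof -
  define B :: "nat \<Rightarrow> real set" where "B = (\<lambda>v. if v \<in> V then {-1..1} else {0})"
  define C where "C = {f :: nat \<Rightarrow> real. (\<Sum>v\<in>V. (f v)\<^sup>2) = 1} \<inter> (\<Inter>v\<in>V. {f. f (\<tau> v) = s * f v})"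
  define K where "K = PiE UNIV B \<inter> C"
  have "compactin (product_topology (\<lambda>i. euclidean) UNIV) (PiE UNIV B)"
    unfolding compactin_PiE by (auto simp: B_def)
  then have "compact (PiE UNIV B)"
    by (simp add: euclidean_product_topology)
  moreover have "closed C"
    unfolding C_def
    by (intro closed_Int closed_INT ballI closed_Collect_eq continuous_intros) auto
  ultimately have "compact K" unfolding K_def by (rule compact_Int_closed)
  define restr where "restr = (\<lambda>(f :: nat \<Rightarrow> real) v. if v \<in> V then f v else 0)"
  have restr: "restr f \<in> K" if "(\<Sum>v\<in>V. (f v)\<^sup>2) = 1" "\<And>v. v \<in> V \<Longrightarrow> f (\<tau> v) = s * f v" for f
  proof -
    have "\<bar>f v\<bar> \<le> 1" if "v \<in> V" for v
      using member_le_sum[of v V "\<lambda>v. (f v)\<^sup>2"] \<open>(\<Sum>v\<in>V. (f v)\<^sup>2) = 1\<close> that V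
      by (simp add: abs_square_le_1)
    then show ?thesis using that \<tau>
      by (auto simp: K_def B_def C_def restr_def abs_le_iff intro: PiE_I)
  qed
  have "K \<noteq> {}" using restr[OF f0] by auto
  moreover have "continuous_on K (qform V h)"
    unfolding qform_def
    by (intro continuous_intros continuous_on_subset[OF continuous_on_product_coordinates]) auto
  ultimately obtain f where f: "f \<in> K" "\<And>g. g \<in> K \<Longrightarrow> qform V h f \<le> qform V h g"
    using continuous_attains_inf[OF \<open>compact K\<close>] by blast
  have min: "qform V h f * (\<Sum>v\<in>V. (g v)\<^sup>2) \<le> qform V h g"
    if g: "\<And>v. v \<in> V \<Longrightarrow> g (\<tau> v) = s * g v" for g
  proof (cases "(\<Sum>v\<in>V. (g v)\<^sup>2) = 0")
    case True
    then have "\<And>v. v \<in> V \<Longrightarrow> g v = 0" using V by (simp add: sum_nonneg_eq_0_iff)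
    then show ?thesis using True by (simp add: qform_def)
  next
    case False
    define N where "N = (\<Sum>v\<in>V. (g v)\<^sup>2)"
    have N: "N > 0" using False sum_nonneg[of V "\<lambda>v. (g v)\<^sup>2"] by (simp add: N_def)
    have "restr (\<lambda>v. g v / sqrt N) \<in> K"
      using N g by (intro restr) (simp_all add: power_divide flip: sum_divide_distrib N_def)
    then have "qform V h f \<le> qform V h (restr (\<lambda>v. g v / sqrt N))" by (rule f)
    also have "\<dots> = (\<Sum>v\<in>V. \<Sum>w\<in>V. g v * h v w * g w / N)"
      unfolding qform_def restr_def using N by (intro sum.cong) (auto simp: field_simps)
    also have "\<dots> = qform V h g / N"
      by (simp add: qform_def sum_divide_distrib)
    finally show ?thesis using N by (simp add: field_simps N_def)
  qed
  show ?thesis using f(1) by (intro that[OF _ _ refl min]) (auto simp: K_def C_def)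
qed

text \<open>Vary \<open>f\<close> along its own residual \<open>r\<close>. Invariance of
  \<open>h\<close> puts \<open>r\<close> in the same sector, so \<open>f + x * r\<close> is
  admissible for every real \<open>x\<close>; the coefficient of the linear term in \<open>x\<close>
  is twice the squared norm of \<open>r\<close>, which must therefore vanish.\<close>

lemma qform_minimizer_eigenvector:
  fixes h :: "nat \<Rightarrow> nat \<Rightarrow> real"
  assumes V: "finite V" and sym: "\<And>v w. v \<in> V \<Longrightarrow> w \<in> V \<Longrightarrow> h v w = h w v"
    and \<tau>: "bij_betw \<tau> V V" and inv: "\<And>a b. a \<in> V \<Longrightarrow> b \<in> V \<Longrightarrow> h (\<tau> a) (\<tau> b) = h a b"
    and min: "\<And>g. (\<And>v. v \<in> V \<Longrightarrow> g (\<tau> v) = s * g v) \<Longrightarrow> l * (\<Sum>v\<in>V. (g v)\<^sup>2) \<le> qform V h g"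
    and f: "\<And>v. v \<in> V \<Longrightarrow> f (\<tau> v) = s * f v" "qform V h f \<le> l * (\<Sum>v\<in>V. (f v)\<^sup>2)"
    and v: "v \<in> V"
  shows "(\<Sum>w\<in>V. h v w * f w) = l * f v"
proof -
  define r where "r = (\<lambda>v. (\<Sum>w\<in>V. h v w * f w) - l * f v)"
  have r\<tau>: "r (\<tau> v) = s * r v" if "v \<in> V" for v
  proof -
    have "(\<Sum>w\<in>V. h (\<tau> v) w * f w) = (\<Sum>w\<in>V. h (\<tau> v) (\<tau> w) * f (\<tau> w))"
      using sum.reindex_bij_betw[OF \<tau>, symmetric] by simp
    also have "\<dots> = s * (\<Sum>w\<in>V. h v w * f w)"
      using inv that f(1) by (simp add: sum_distrib_left mult_ac)
    finally show ?thesis using f(1)[OF that] by (simp add: r_def algebra_simps)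
  qed
  define n where "n = (\<Sum>v\<in>V. (r v)\<^sup>2)"
  define c where "c = qform V h r - l * n"
  have "0 \<le> x\<^sup>2 * c + 2 * x * n" for x
  proof -
    define X where "X = (\<Sum>v\<in>V. r v * f v)"
    define Y where "Y = (\<Sum>v\<in>V. \<Sum>w\<in>V. r v * h v w * f w)"
    have Y': "(\<Sum>v\<in>V. \<Sum>w\<in>V. f v * h v w * r w) = Y"
      unfolding Y_def using sym by (subst sum.swap) (simp add: mult_ac)
    have "qform V h (\<lambda>v. f v + x * r v)
        = qform V h f + x * (Y + (\<Sum>v\<in>V. \<Sum>w\<in>V. f v * h v w * r w)) + x\<^sup>2 * qform V h r"
      by (simp add: qform_def Y_def algebra_simps sum.distrib sum_distrib_left power2_eq_square)
    moreover have "(\<Sum>v\<in>V. (f v + x * r v)\<^sup>2) = (\<Sum>v\<in>V. (f v)\<^sup>2) + 2 * x * X + x\<^sup>2 * n"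
      by (simp add: n_def X_def algebra_simps sum.distrib sum_distrib_left power2_eq_square)
    moreover have "l * (\<Sum>v\<in>V. (f v + x * r v)\<^sup>2) \<le> qform V h (\<lambda>v. f v + x * r v)"
      using f(1) r\<tau> by (intro min) (simp add: algebra_simps)
    moreover have "n = Y - l * X"
      unfolding n_def Y_def X_def power2_eq_square
      by (subst (2) r_def) (simp add: algebra_simps sum_subtractf sum_distrib_left)
    ultimately have "l * ((\<Sum>v\<in>V. (f v)\<^sup>2) + 2 * x * X + x\<^sup>2 * n)
        \<le> l * (\<Sum>v\<in>V. (f v)\<^sup>2) + 2 * x * (n + l * X) + x\<^sup>2 * qform V h r"
      using f(2) unfolding Y' by simp
    then show ?thesis unfolding c_def by (simp add: algebra_simps)
  qed
  note * = this
  have "n \<ge> 0" by (simp add: n_def sum_nonneg)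
  have "n = 0"
  proof (rule ccontr)
    assume "n \<noteq> 0"
    with \<open>n \<ge> 0\<close> have "n > 0" by simp
    \<comment> \<open>A negative \<open>x\<close> so small that \<open>x * c\<close> is at most
      \<open>n\<close> in absolute value: the linear term then dominates and the quadratic
      expression becomes negative.\<close>
    define x where "x = - n / (\<bar>c\<bar> + 1)"
    have "x < 0" using \<open>n > 0\<close> by (simp add: x_def divide_neg_pos)
    have "0 \<le> x * (x * c + 2 * n)" using *[of x] by (simp add: power2_eq_square algebra_simps)
    then have "x * c + 2 * n \<le> 0" using \<open>x < 0\<close> by (simp add: zero_le_mult_iff)
    moreover have "\<bar>x * c\<bar> \<le> n"
      using \<open>n > 0\<close> by (simp add: x_def abs_mult field_simps)
    ultimately show False using \<open>n > 0\<close> by linarith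
  qed
  then have "r v = 0" using v V by (simp add: n_def sum_nonneg_eq_0_iff)
  then show ?thesis by (simp add: r_def)
qed

text \<open>Diagonal terms see only absolute values; off the diagonal, making a product nonnegative
  can only lower a term with a nonpositive coefficient.\<close>

lemma qform_abs_le:
  fixes h :: "nat \<Rightarrow> nat \<Rightarrow> real"
  assumes offdiag: "\<And>v w. v \<in> V \<Longrightarrow> w \<in> V \<Longrightarrow> v \<noteq> w \<Longrightarrow> h v w \<le> 0"
  shows "qform V h (\<lambda>v. \<bar>f v\<bar>) \<le> qform V h f"
  unfolding qform_def
proof (intro sum_mono)
  fix v w assume vw: "v \<in> V" "w \<in> V"
  show "\<bar>f v\<bar> * h v w * \<bar>f w\<bar> \<le> f v * h v w * f w"
  proof (cases "v = w")
    case True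
    then show ?thesis by (simp add: mult.commute[of "h w w"] flip: mult.assoc)
  next
    case False
    have "h v w * \<bar>f v * f w\<bar> \<le> h v w * (f v * f w)"
      by (rule mult_left_mono_neg) (simp_all add: offdiag[OF vw False])
    then show ?thesis by (simp add: abs_mult mult_ac)
  qed
qed

text \<open>A Perron-Frobenius argument. The absolute value of \<open>f\<close> also attains the
  minimum, hence is an eigenvector. At one of its zeros the eigenvalue equation is a vanishing sum
  of terms of one sign, so it vanishes at all neighbours, and by connectedness everywhere.\<close>

lemma ground_state_vanishing:
  fixes h :: "nat \<Rightarrow> nat \<Rightarrow> real"
  assumes V: "finite V" and sym: "\<And>v w. v \<in> V \<Longrightarrow> w \<in> V \<Longrightarrow> h v w = h w v"
    and min: "\<And>g. l * (\<Sum>v\<in>V. (g v)\<^sup>2) \<le> qform V h g"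
    and eig: "\<And>v. v \<in> V \<Longrightarrow> (\<Sum>w\<in>V. h v w * f w) = l * f v"
    and offdiag: "\<And>v w. v \<in> V \<Longrightarrow> w \<in> V \<Longrightarrow> v \<noteq> w \<Longrightarrow> h v w \<le> 0"
    and conn: "\<And>v w. v \<in> V \<Longrightarrow> w \<in> V \<Longrightarrow> E\<^sup>*\<^sup>* v w"
    and E: "\<And>v w. E v w \<Longrightarrow> v \<in> V \<and> w \<in> V \<and> v \<noteq> w \<and> h v w < 0"
    and u: "u \<in> V" "f u = 0" and v: "v \<in> V"
  shows "f v = 0"
proof -
  define g where "g = (\<lambda>v. \<bar>f v\<bar>)"
  have "qform V h g \<le> qform V h f"
    unfolding g_def by (rule qform_abs_le) (rule offdiag)
  also have "qform V h f = (\<Sum>v\<in>V. f v * (\<Sum>w\<in>V. h v w * f w))"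
    by (simp add: qform_def sum_distrib_left mult.assoc)
  also have "\<dots> = l * (\<Sum>v\<in>V. (g v)\<^sup>2)"
    unfolding sum_distrib_left[of l] by (intro sum.cong) (simp_all add: eig g_def power2_eq_square)
  finally have eig': "(\<Sum>w\<in>V. h v w * g w) = l * g v" if "v \<in> V" for v
    using that by (intro qform_minimizer_eigenvector[OF V sym bij_betw_id, where s = 1]) (auto intro: min)
  have step: "g w = 0" if "E v w" "g v = 0" for v w
  proof -
    have vw: "v \<in> V" "w \<in> V" "v \<noteq> w" "h v w < 0" using E[OF that(1)] by auto
    have "(\<Sum>w\<in>V. - (h v w * g w)) = 0" using eig'[OF vw(1)] that(2) by (simp add: sum_negf)
    moreover have "0 \<le> - (h v w * g w)" if "w \<in> V" for w
    proof (cases "v = w")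
      case False
      then show ?thesis using offdiag[OF vw(1) that] by (simp add: g_def mult_nonpos_nonneg)
    qed (use \<open>g v = 0\<close> in simp)
    ultimately have "h v w * g w = 0" using V vw(2) by (simp add: sum_nonneg_eq_0_iff)
    then show ?thesis using vw by simp
  qed
  have "E\<^sup>*\<^sup>* u v" by (rule conn[OF u(1) v])
  then have "g v = 0"
    by (induction rule: rtranclp_induct) (use u step in \<open>auto simp: g_def\<close>)
  then show ?thesis by (simp add: g_def)
qed

section \<open>Wells on a graph\<close>

text \<open>The real form of \<open>ham\<close>, so that the variational arguments stay over the
  reals.\<close>

definition rham :: "nat set \<Rightarrow> (nat \<Rightarrow> nat \<Rightarrow> bool) \<Rightarrow> nat set \<Rightarrow> real \<Rightarrow> nat \<Rightarrow> nat \<Rightarrow> real" where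
  "rham V E Wl Q v w = lap V E v w - Q * (if v = w \<and> v \<in> Wl then 1 else 0)"

lemma evol_eq_mat_exp:
  "evol V E Wl Q t u v = mat_exp V (\<lambda>a b. \<i> * of_real t * of_real (rham V E Wl Q a b)) v u"
  by (simp add: evol_def ham_def rham_def)

text \<open>Each edge term is completed to the square of
  \<open>f v / sqrt (d v) - f w / sqrt (d w)\<close>. The square terms taken out, summed over the
  neighbours of \<open>v\<close>, add up to at most the diagonal contribution of
  \<open>v\<close>.\<close>

lemma qform_lap_nonneg:
  assumes G: "graph V E"
  shows "0 \<le> qform V (lap V E) f"
proof -
  have V: "finite V" and E: "\<And>a b. E a b \<longleftrightarrow> E b a" "\<And>a. \<not> E a a" using G by (auto simp: graph_def)
  define d where "d = (\<lambda>v. real (deg V E v))"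
  define e where "e = (\<lambda>v w. of_bool (E v w) :: real)"
  have d: "(\<Sum>w\<in>V. e v w) = d v" for v
    using V by (simp add: e_def d_def deg_def of_bool_def sum.If_cases Int_def)
  have d0: "d v \<ge> 0" for v by (simp add: d_def)
  have "(if v = w then (f v)\<^sup>2 else 0) - e v w * ((f v)\<^sup>2 / d v) / 2 - e w v * ((f w)\<^sup>2 / d w) / 2
      \<le> f v * lap V E v w * f w" for v w
  proof (cases "E v w")
    case True
    have "0 \<le> (f v / sqrt (d v) - f w / sqrt (d w))\<^sup>2" by simp
    also have "\<dots> = (f v)\<^sup>2 / d v + (f w)\<^sup>2 / d w - 2 * (f v * f w / sqrt (d v * d w))"
      using d0 by (simp add: power2_diff power_divide real_sqrt_mult)
    finally show ?thesis using True E by (auto simp: e_def lap_def d_def)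
  next
    case False
    then show ?thesis using E by (auto simp: e_def lap_def power2_eq_square)
  qed
  then have "(\<Sum>v\<in>V. \<Sum>w\<in>V. (if v = w then (f v)\<^sup>2 else 0) - e v w * ((f v)\<^sup>2 / d v) / 2
      - e w v * ((f w)\<^sup>2 / d w) / 2) \<le> qform V (lap V E) f"
    unfolding qform_def by (intro sum_mono)
  moreover have "(\<Sum>v\<in>V. \<Sum>w\<in>V. e v w * ((f v)\<^sup>2 / d v) / 2) = (\<Sum>v\<in>V. d v * ((f v)\<^sup>2 / d v) / 2)"
    by (simp only: d sum_distrib_right[symmetric] sum_divide_distrib[symmetric])
  moreover have "(\<Sum>v\<in>V. \<Sum>w\<in>V. e w v * ((f w)\<^sup>2 / d w) / 2) = (\<Sum>v\<in>V. d v * ((f v)\<^sup>2 / d v) / 2)"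
    by (subst sum.swap) (simp only: d sum_distrib_right[symmetric] sum_divide_distrib[symmetric])
  \<comment> \<open>Strict only at isolated vertices, where \<open>d v = 0\<close> and the left-hand
    term is 0.\<close>
  moreover have "(\<Sum>v\<in>V. d v * ((f v)\<^sup>2 / d v) / 2) \<le> (\<Sum>v\<in>V. (f v)\<^sup>2 / 2)"
    by (intro sum_mono) auto
  moreover have "(\<Sum>v\<in>V. \<Sum>w\<in>V. (if v = w then (f v)\<^sup>2 else 0)) = (\<Sum>v\<in>V. (f v)\<^sup>2)"
    using V by simp
  ultimately show ?thesis by (simp add: sum_subtractf flip: sum_divide_distrib)
qed

lemma qform_rham:
  assumes "finite V" "Wl \<subseteq> V"
  shows "qform V (rham V E Wl Q) f = qform V (lap V E) f - Q * (\<Sum>v\<in>Wl. (f v)\<^sup>2)"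
proof -
  have "qform V (rham V E Wl Q) f
      = qform V (lap V E) f - (\<Sum>v\<in>V. \<Sum>w\<in>V. if w = v then Q * (if v \<in> Wl then (f v)\<^sup>2 else 0) else 0)"
    unfolding qform_def rham_def sum_subtractf[symmetric]
    by (intro sum.cong refl) (auto simp: algebra_simps power2_eq_square)
  also have "\<dots> = qform V (lap V E) f - Q * (\<Sum>v\<in>V. if v \<in> Wl then (f v)\<^sup>2 else 0)"
    using assms by (simp add: sum_distrib_left)
  also have "(\<Sum>v\<in>V. if v \<in> Wl then (f v)\<^sup>2 else 0) = (\<Sum>v\<in>Wl. (f v)\<^sup>2)"
    using assms by (simp add: sum.If_cases Int_absorb1)
  finally show ?thesis .
qed

section \<open>Graph automorphisms and the Hamiltonian\<close>

definition automorphism :: "nat set \<Rightarrow> (nat \<Rightarrow> nat \<Rightarrow> bool) \<Rightarrow> (nat \<Rightarrow> nat) \<Rightarrow> bool" where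
  "automorphism V E \<tau> \<longleftrightarrow> bij_betw \<tau> V V \<and> (\<forall>a\<in>V. \<forall>b\<in>V. E (\<tau> a) (\<tau> b) \<longleftrightarrow> E a b)"

lemma automorphism_deg:
  assumes "automorphism V E \<tau>" "v \<in> V"
  shows "deg V E (\<tau> v) = deg V E v"
proof -
  have bij: "bij_betw \<tau> V V" using assms by (simp add: automorphism_def)
  have "{w \<in> V. E (\<tau> v) w} = \<tau> ` {w \<in> V. E v w}"
    using assms bij by (force simp: automorphism_def bij_betw_def)
  moreover have "inj_on \<tau> {w \<in> V. E v w}"
    using bij by (auto simp: bij_betw_def intro: inj_on_subset)
  ultimately show ?thesis by (simp add: deg_def card_image)
qed

lemma automorphism_rham:
  assumes "automorphism V E \<tau>" "\<And>v. v \<in> V \<Longrightarrow> \<tau> v \<in> Wl \<longleftrightarrow> v \<in> Wl" "a \<in> V" "b \<in> V"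
  shows "rham V E Wl Q (\<tau> a) (\<tau> b) = rham V E Wl Q a b"
proof -
  have "\<tau> a = \<tau> b \<longleftrightarrow> a = b"
    using assms by (auto simp: automorphism_def bij_betw_def inj_on_def)
  then show ?thesis using assms automorphism_deg[OF assms(1)]
    by (simp add: rham_def lap_def automorphism_def)
qed

section \<open>Low-energy eigenstates on a graph with wells\<close>

locale well_graph =
  fixes V :: "nat set" and E :: "nat \<Rightarrow> nat \<Rightarrow> bool" and Wl :: "nat set"
  assumes conn: "connected_graph V E" and Wl: "Wl \<subseteq> V"
    and no_edge: "\<And>a b. a \<in> Wl \<Longrightarrow> b \<in> Wl \<Longrightarrow> \<not> E a b"
begin

abbreviation "h \<equiv> rham V E Wl"

lemma graph: "graph V E" using conn by (simp add: connected_graph_def)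

lemma finite_V: "finite V" using graph by (simp add: graph_def)

lemma rham_sym: "h Q v w = h Q w v"
  using graph by (auto simp: rham_def lap_def graph_def mult.commute)

lemma sum_supported:
  assumes "\<And>v. v \<notin> Wl \<Longrightarrow> F v = (0::'a::comm_monoid_add)"
  shows "(\<Sum>v\<in>V. F v) = (\<Sum>v\<in>Wl. F v)"
  using assms Wl finite_V by (intro sum.mono_neutral_right) auto

text \<open>Wells are pairwise nonadjacent, so only diagonal entries survive. This makes functions
  on the wells trial states of energy \<open>1 - Q\<close>.\<close>

lemma qform_supported:
  assumes "\<And>v. v \<notin> Wl \<Longrightarrow> f v = 0"
  shows "qform V (h Q) f = (1 - Q) * (\<Sum>v\<in>V. (f v)\<^sup>2)"
proof -
  have "qform V (lap V E) f = (\<Sum>v\<in>V. \<Sum>w\<in>V. if w = v then (f v)\<^sup>2 else 0)"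
    unfolding qform_def using no_edge assms
    by (intro sum.cong refl) (auto simp: lap_def power2_eq_square)
  also have "\<dots> = (\<Sum>v\<in>V. (f v)\<^sup>2)" using finite_V by simp
  also have "\<dots> = (\<Sum>v\<in>Wl. (f v)\<^sup>2)" using assms by (intro sum_supported) auto
  finally show ?thesis
    using sum_supported[of "\<lambda>v. (f v)\<^sup>2"] assms
    by (simp add: qform_rham[OF finite_V Wl] algebra_simps)
qed

text \<open>The bound on \<open>l\<close> is the energy reached by trial states on the wells; it is
  what forces localization there.\<close>

definition eigenstate :: "real \<Rightarrow> real \<Rightarrow> (nat \<Rightarrow> real) \<Rightarrow> bool" where
  "eigenstate Q l f \<longleftrightarrow> (\<Sum>v\<in>V. (f v)\<^sup>2) = 1 \<and> (\<forall>v\<in>V. (\<Sum>w\<in>V. h Q v w * f w) = l * f v) \<and> l \<le> 1 - Q"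

lemma eigenstate_localized:
  assumes "eigenstate Q l f" "Q > 0"
  shows "(\<Sum>v\<in>Wl. (f v)\<^sup>2) \<ge> 1 - 1 / Q"
proof -
  have "qform V (h Q) f = (\<Sum>v\<in>V. f v * (\<Sum>w\<in>V. h Q v w * f w))"
    by (simp add: qform_def sum_distrib_left mult.assoc)
  also have "\<dots> = (\<Sum>v\<in>V. l * (f v)\<^sup>2)"
    using assms by (intro sum.cong) (auto simp: eigenstate_def power2_eq_square)
  also have "\<dots> = l"
    using assms by (simp add: eigenstate_def flip: sum_distrib_left)
  finally have "qform V (lap V E) f - Q * (\<Sum>v\<in>Wl. (f v)\<^sup>2) \<le> 1 - Q"
    using assms by (simp add: qform_rham[OF finite_V Wl] eigenstate_def)
  then have "Q - 1 \<le> Q * (\<Sum>v\<in>Wl. (f v)\<^sup>2)"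
    using qform_lap_nonneg[OF graph, of f] by linarith
  then show ?thesis using assms(2) by (simp add: field_simps)
qed

lemma eigenstate_phase:
  assumes "eigenstate Q l \<psi>" and \<phi>: "(\<Sum>v\<in>Wl. (\<phi> v)\<^sup>2) = 1" "\<And>v. v \<notin> Wl \<Longrightarrow> \<phi> v = 0"
    and "(\<Sum>v\<in>Wl. \<phi> v * \<psi> v)\<^sup>2 \<ge> 1 - e"
  shows "cmod ((\<Sum>v\<in>Wl. \<Sum>w\<in>Wl. of_real (\<phi> v) * evol V E Wl Q t w v * of_real (\<phi> w)) - cis (t * l))
    \<le> e + sqrt e"
proof -
  have "(\<Sum>v\<in>V. \<Sum>w\<in>V. of_real (\<phi> v) * evol V E Wl Q t w v * of_real (\<phi> w))
      = (\<Sum>v\<in>Wl. \<Sum>w\<in>Wl. of_real (\<phi> v) * evol V E Wl Q t w v * of_real (\<phi> w))"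
    by (subst sum_supported, simp add: \<phi>(2), intro sum.cong refl sum_supported) (simp add: \<phi>(2))
  then show ?thesis
    using return_amplitude_near_phase[where h = "h Q" and \<psi> = \<psi> and l = l and \<phi> = \<phi>
        and e = e and t = t, OF finite_V rham_sym] assms
      sum_supported[of "\<lambda>v. (\<phi> v)\<^sup>2"] sum_supported[of "\<lambda>v. \<phi> v * \<psi> v"]
    by (simp add: evol_eq_mat_exp eigenstate_def)
qed

lemma evol_element_le:
  assumes "(\<Sum>v\<in>Wl. (\<phi> v)\<^sup>2) = 1" "(\<Sum>v\<in>Wl. (\<theta> v)\<^sup>2) = 1"
    "\<And>v. v \<notin> Wl \<Longrightarrow> \<phi> v = 0" "\<And>v. v \<notin> Wl \<Longrightarrow> \<theta> v = 0"
  shows "cmod (\<Sum>v\<in>Wl. \<Sum>w\<in>Wl. of_real (\<phi> v) * evol V E Wl Q t w v * of_real (\<theta> w)) \<le> 1"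
proof -
  have "(\<Sum>v\<in>V. \<Sum>w\<in>V. of_real (\<phi> v) * evol V E Wl Q t w v * of_real (\<theta> w))
      = (\<Sum>v\<in>Wl. \<Sum>w\<in>Wl. of_real (\<phi> v) * evol V E Wl Q t w v * of_real (\<theta> w))"
    by (subst sum_supported, simp add: assms, intro sum.cong refl sum_supported) (simp add: assms)
  then show ?thesis
    using mat_exp_matrix_element_le[where h = "h Q" and f = \<phi> and g = \<theta> and t = t,
        OF finite_V rham_sym] assms
      sum_supported[of "\<lambda>v. (\<phi> v)\<^sup>2"] sum_supported[of "\<lambda>v. (\<theta> v)\<^sup>2"]
    by (simp add: evol_eq_mat_exp)
qed

definition ground_state :: "real \<Rightarrow> real \<Rightarrow> (nat \<Rightarrow> real) \<Rightarrow> bool" where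
  "ground_state Q l f \<longleftrightarrow> eigenstate Q l f \<and> (\<forall>v\<in>V. f v > 0)
    \<and> (\<forall>g. l * (\<Sum>v\<in>V. (g v)\<^sup>2) \<le> qform V (h Q) g)"

lemma ground_energy_vanishing:
  assumes "\<And>g. l * (\<Sum>v\<in>V. (g v)\<^sup>2) \<le> qform V (h Q) g"
    and "\<And>v. v \<in> V \<Longrightarrow> (\<Sum>w\<in>V. h Q v w * f w) = l * f v"
    and "u \<in> V" "f u = 0" "v \<in> V"
  shows "f v = 0"
proof (rule ground_state_vanishing[where h = "h Q", OF finite_V rham_sym assms(1,2) _ _ _ assms(3-5)])
  show "h Q v w \<le> 0" if "v \<noteq> w" for v w using that by (simp add: rham_def lap_def)
  show "E\<^sup>*\<^sup>* v w" if "v \<in> V" "w \<in> V" for v w using conn that by (simp add: connected_graph_def)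
  show "v \<in> V \<and> w \<in> V \<and> v \<noteq> w \<and> h Q v w < 0" if "E v w" for v w
  proof -
    have vw: "v \<in> V" "w \<in> V" "v \<noteq> w" "E w v" using that graph by (auto simp: graph_def)
    then have "deg V E v > 0" "deg V E w > 0"
      using that finite_V by (auto simp: deg_def card_gt_0_iff)
    then show ?thesis using vw that by (simp add: rham_def lap_def)
  qed
qed

text \<open>The absolute value of an unrestricted minimizer is again a minimizer, and a zero of it
  would spread over the whole graph. The indicator \<open>f0\<close> of one well serves as the trial
  state for \<open>l \<le> 1 - Q\<close>.\<close>

lemma ground_state_exists:
  assumes "Wl \<noteq> {}"
  obtains l \<psi> where "ground_state Q l \<psi>"
proof -
  obtain u where u: "u \<in> Wl" using assms by auto
  define f0 where "f0 = (\<lambda>v. of_bool (v = u) :: real)"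
  have f0: "(\<Sum>v\<in>V. (f0 v)\<^sup>2) = 1"
    using u Wl finite_V by (auto simp: f0_def if_distrib[of "\<lambda>x. x ^ _"] of_bool_def cong: if_cong)
  obtain f l where f: "(\<Sum>v\<in>V. (f v)\<^sup>2) = 1" "qform V (h Q) f = l"
    and min: "\<And>g. l * (\<Sum>v\<in>V. (g v)\<^sup>2) \<le> qform V (h Q) g"
    using qform_minimizer_exists[OF finite_V, of id f0 1 "h Q"] f0 by auto
  have "l \<le> 1 - Q"
  proof -
    have "qform V (h Q) f0 = 1 - Q" using qform_supported[of f0 Q] f0 u by (force simp: f0_def)
    then show ?thesis using min[of f0] f0 by simp
  qed
  define \<psi> where "\<psi> = (\<lambda>v. \<bar>f v\<bar>)"
  have n: "(\<Sum>v\<in>V. (\<psi> v)\<^sup>2) = 1" using f by (simp add: \<psi>_def)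
  have "qform V (h Q) \<psi> \<le> qform V (h Q) f"
    unfolding \<psi>_def by (rule qform_abs_le) (simp add: rham_def lap_def)
  then have le: "qform V (h Q) \<psi> \<le> l * (\<Sum>v\<in>V. (\<psi> v)\<^sup>2)" by (simp add: n f(2))
  have eig: "(\<Sum>w\<in>V. h Q v w * \<psi> w) = l * \<psi> v" if "v \<in> V" for v
    by (rule qform_minimizer_eigenvector[where h = "h Q" and s = 1,
          OF finite_V rham_sym bij_betw_id _ min _ le that])
      simp_all
  have "\<psi> v > 0" if "v \<in> V" for v
  proof (rule ccontr)
    assume "\<not> \<psi> v > 0"
    then have "\<psi> v = 0" by (simp add: \<psi>_def)
    then have "\<psi> w = 0" if "w \<in> V" for w
      using ground_energy_vanishing[OF min eig \<open>v \<in> V\<close>] that by blast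
    then show False using n by simp
  qed
  then have "ground_state Q l \<psi>"
    using n eig \<open>l \<le> 1 - Q\<close> min by (auto simp: ground_state_def eigenstate_def)
  then show ?thesis by (rule that)
qed

lemma ground_state_invariant:
  assumes \<psi>: "ground_state Q l \<psi>" and \<tau>: "automorphism V E \<tau>" "\<And>v. v \<in> V \<Longrightarrow> \<tau> v \<in> Wl \<longleftrightarrow> v \<in> Wl"
    and u: "u \<in> V" "\<tau> u = u" and v: "v \<in> V"
  shows "\<psi> (\<tau> v) = \<psi> v"
proof -
  have eig: "(\<Sum>w\<in>V. h Q v w * \<psi> w) = l * \<psi> v" if "v \<in> V" for v
    using \<psi> that by (auto simp: ground_state_def eigenstate_def)
  have bij: "bij_betw \<tau> V V" using \<tau> by (simp add: automorphism_def)
  have eig': "(\<Sum>w\<in>V. h Q v w * \<psi> (\<tau> w)) = l * \<psi> (\<tau> v)" if "v \<in> V" for v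
  proof -
    have "(\<Sum>w\<in>V. h Q v w * \<psi> (\<tau> w)) = (\<Sum>w\<in>V. h Q (\<tau> v) (\<tau> w) * \<psi> (\<tau> w))"
      using automorphism_rham[OF \<tau> that] by simp
    also have "\<dots> = (\<Sum>w\<in>V. h Q (\<tau> v) w * \<psi> w)"
      by (rule sum.reindex_bij_betw[OF bij])
    also have "\<dots> = l * \<psi> (\<tau> v)" using eig bij that by (auto simp: bij_betw_def)
    finally show ?thesis .
  qed
  \<comment> \<open>The difference is a ground eigenvector vanishing at the fixed point.\<close>
  have "\<psi> (\<tau> v) - \<psi> v = 0"
    by (rule ground_energy_vanishing[where u = u and l = l and Q = Q])
      (use \<psi> eig eig' u v in \<open>auto simp: ground_state_def algebra_simps sum_subtractf\<close>)
  then show ?thesis by simp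
qed

end

section \<open>Tunneling between three wells\<close>

text \<open>The supremum over time is squeezed between \<open>(r - \<delta> Q)\<^sup>2\<close> and
  \<open>r\<^sup>2\<close>, so it converges and its limit is the \<open>Liminf\<close>.\<close>

lemma TC_eqI:
  assumes upper: "\<And>Q t. cmod (evol V E Wl Q t u v) \<le> r"
    and lower: "\<forall>\<^sub>F Q in at_top. \<exists>t\<ge>0. r - \<delta> Q \<le> cmod (evol V E Wl Q t u v)"
    and \<delta>: "(\<delta> \<longlongrightarrow> 0) at_top" and r: "r > 0"
  shows "TC V E Wl u v = ereal (r\<^sup>2)"
proof -
  let ?S = "\<lambda>Q. SUP t\<in>{0::real..}. ereal ((cmod (evol V E Wl Q t u v))\<^sup>2)"
  have "?S Q \<le> ereal (r\<^sup>2)" for Q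
    using upper by (intro SUP_least) (auto intro!: power_mono)
  moreover have "((\<lambda>Q. ereal ((r - \<delta> Q)\<^sup>2)) \<longlongrightarrow> ereal ((r - 0)\<^sup>2)) at_top"
    by (intro tendsto_intros \<delta>)
  \<comment> \<open>Eventually \<open>r - \<delta> Q\<close> is positive, so the lower bound
    survives squaring.\<close>
  moreover have "\<forall>\<^sub>F Q in at_top. \<delta> Q < r"
    using order_tendstoD(2)[OF \<delta> r] .
  with lower have "\<forall>\<^sub>F Q in at_top. ereal ((r - \<delta> Q)\<^sup>2) \<le> ?S Q"
  proof eventually_elim
    case (elim Q)
    then obtain t where "t \<ge> 0" "r - \<delta> Q \<le> cmod (evol V E Wl Q t u v)" by auto
    with elim show ?case by (intro SUP_upper2[of t]) (auto intro!: power_mono)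
  qed
  ultimately have "(?S \<longlongrightarrow> ereal (r\<^sup>2)) at_top"
    by (intro tendsto_sandwich[of "\<lambda>Q. ereal ((r - \<delta> Q)\<^sup>2)" ?S at_top "\<lambda>_. ereal (r\<^sup>2)"]) auto
  then show ?thesis unfolding TC_def by (intro lim_imp_Liminf) auto
qed

lemma tendsto_one_over_at_top: "((\<lambda>Q::real. 1 / Q) \<longlongrightarrow> 0) at_top"
  using tendsto_inverse_0_at_top[OF filterlim_ident] by (simp add: divide_inverse)

text \<open>However small the gap between the frequencies, some time makes the two phases opposite.
  That time depends on the frequencies alone, so it is fixed before the amplitudes, whose distance
  from the phases is controlled at every time.\<close>

lemma opposite_phases:
  assumes "l \<noteq> m"
  obtains t where "t \<ge> 0" "\<And>a b e1 e2. cmod (a - cis (t * l)) \<le> e1 \<Longrightarrow> cmod (b - cis (t * m)) \<le> e2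
    \<Longrightarrow> 2 - (e1 + e2) \<le> cmod (a - b)"
proof
  define t where "t = pi / \<bar>l - m\<bar>"
  show "t \<ge> 0" by (simp add: t_def)
  fix a b e1 e2 assume ab: "cmod (a - cis (t * l)) \<le> e1" "cmod (b - cis (t * m)) \<le> e2"
  have "t * (l - m) = pi \<or> t * (l - m) = - pi"
    using assms by (auto simp: t_def abs_if field_simps)
  then have "cis (t * (l - m)) = -1" by (auto simp: complex_eq_iff)
  moreover have "cis (t * l) = cis (t * m) * cis (t * (l - m))"
    by (simp add: cis_mult algebra_simps)
  ultimately have "cis (t * l) - cis (t * m) = - 2 * cis (t * m)" by simp
  then have "2 = cmod (cis (t * l) - cis (t * m))" by (simp only: norm_mult) simp
  also have "cis (t * l) - cis (t * m) = (a - b) - (a - cis (t * l)) + (b - cis (t * m))" by simp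
  also have "cmod \<dots> \<le> cmod (a - b) + cmod (a - cis (t * l)) + cmod (b - cis (t * m))"
    using norm_triangle_ineq[of "(a - b) - (a - cis (t * l))" "b - cis (t * m)"]
      norm_triangle_ineq4[of "a - b" "a - cis (t * l)"] by linarith
  finally show "2 - (e1 + e2) \<le> cmod (a - b)" using ab by linarith
qed

section \<open>Three wells with a reflection fixing one of them\<close>

locale triple_well = well_graph V E "{x, y, z}" for V E x y z +
  fixes \<sigma> :: "nat \<Rightarrow> nat"
  assumes distinct: "x \<noteq> y" "y \<noteq> z" "x \<noteq> z"
    and auto_\<sigma>: "automorphism V E \<sigma>" and \<sigma>: "\<sigma> x = x" "\<sigma> y = z" "\<sigma> z = y"
begin

abbreviation "U Q t u v \<equiv> evol V E {x, y, z} Q t u v"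

lemma in_V: "x \<in> V" "y \<in> V" "z \<in> V" using Wl by auto

lemma wells_invariant:
  assumes "automorphism V E \<tau>" "\<tau> ` {x, y, z} = {x, y, z}" "v \<in> V"
  shows "\<tau> v \<in> {x, y, z} \<longleftrightarrow> v \<in> {x, y, z}"
  using inj_on_image_mem_iff[of \<tau> V v "{x, y, z}"] assms in_V
  by (simp only: automorphism_def bij_betw_def) simp

lemma evol_invariant:
  assumes "automorphism V E \<tau>" "\<tau> ` {x, y, z} = {x, y, z}" "u \<in> V" "v \<in> V"
  shows "U Q t (\<tau> u) (\<tau> v) = U Q t u v"
  unfolding evol_eq_mat_exp using assms
  by (intro mat_exp_invariant)
    (auto simp: automorphism_rham[OF assms(1) wells_invariant[OF assms(1,2)]] automorphism_def)

lemma \<sigma>_wells: "\<sigma> ` {x, y, z} = {x, y, z}" using \<sigma> by auto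

lemma evol_swap: "U Q t z z = U Q t y y" "U Q t z y = U Q t y z"
  using evol_invariant[OF auto_\<sigma> \<sigma>_wells, of y y Q t] evol_invariant[OF auto_\<sigma> \<sigma>_wells, of y z Q t]
    in_V \<sigma> by auto

lemma sum_wells: "(\<Sum>v\<in>{x, y, z}. F v) = F x + F y + (F z :: 'a :: comm_monoid_add)" for F
  using distinct by (simp add: add.assoc)

definition odd_vec :: "nat \<Rightarrow> real" where
  "odd_vec v = (if v = y then 1 / sqrt 2 else if v = z then - 1 / sqrt 2 else 0)"

lemma odd_vec: "(\<Sum>v\<in>{x, y, z}. (odd_vec v)\<^sup>2) = 1" "v \<notin> {x, y, z} \<Longrightarrow> odd_vec v = 0"
  using distinct by (simp_all add: odd_vec_def power_divide)

text \<open>Minimization within the odd sector. \<open>odd_vec\<close> shows that the sector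
  contains a unit vector and bounds the minimal energy by \<open>1 - Q\<close>.\<close>

lemma odd_state_exists:
  obtains m f where "eigenstate Q m f" "\<And>v. v \<in> V \<Longrightarrow> f (\<sigma> v) = - f v"
proof -
  have bij: "bij_betw \<sigma> V V" using auto_\<sigma> by (simp add: automorphism_def)
  have n: "(\<Sum>v\<in>V. (odd_vec v)\<^sup>2) = 1"
    using sum_supported[of "\<lambda>v. (odd_vec v)\<^sup>2"] odd_vec by simp
  have "\<sigma> v = y \<longleftrightarrow> v = z" "\<sigma> v = z \<longleftrightarrow> v = y" if "v \<in> V" for v
    using bij \<sigma> in_V that by (auto simp: bij_betw_def inj_on_def)
  then have odd: "odd_vec (\<sigma> v) = - 1 * odd_vec v" if "v \<in> V" for v
    using that distinct by (auto simp: odd_vec_def)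
  have maps: "\<sigma> v \<in> V" if "v \<in> V" for v using bij that by (auto simp: bij_betw_def)
  obtain f m where f: "(\<Sum>v\<in>V. (f v)\<^sup>2) = 1" "\<And>v. v \<in> V \<Longrightarrow> f (\<sigma> v) = - 1 * f v"
    "qform V (h Q) f = m"
    and min: "\<And>g. (\<And>v. v \<in> V \<Longrightarrow> g (\<sigma> v) = - 1 * g v) \<Longrightarrow> m * (\<Sum>v\<in>V. (g v)\<^sup>2) \<le> qform V (h Q) g"
    using qform_minimizer_exists[where h = "h Q", OF finite_V maps n odd] by blast
  have "(\<Sum>w\<in>V. h Q v w * f w) = m * f v" if "v \<in> V" for v
  proof (rule qform_minimizer_eigenvector[where \<tau> = \<sigma> and s = "- 1"])
    show "h Q (\<sigma> a) (\<sigma> b) = h Q a b" if "a \<in> V" "b \<in> V" for a b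
      by (rule automorphism_rham[OF auto_\<sigma> wells_invariant[OF auto_\<sigma> \<sigma>_wells] that])
    show "m * (\<Sum>v\<in>V. (g v)\<^sup>2) \<le> qform V (h Q) g" if "\<And>v. v \<in> V \<Longrightarrow> g (\<sigma> v) = - 1 * g v" for g
      using that by (rule min)
    show "qform V (h Q) f \<le> m * (\<Sum>v\<in>V. (f v)\<^sup>2)" by (simp add: f(1,3))
  qed (rule finite_V rham_sym bij f(2) that | assumption)+
  moreover have "m \<le> 1 - Q"
  proof -
    have "qform V (h Q) odd_vec = 1 - Q"
      using qform_supported[of odd_vec Q] odd_vec(2) n by simp
    then show ?thesis using min[of odd_vec, OF odd] n by simp
  qed
  ultimately have "eigenstate Q m f" using f by (simp add: eigenstate_def)
  then show ?thesis using f(2) by (intro that) auto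
qed

definition odd_amp :: "real \<Rightarrow> real \<Rightarrow> complex" where
  "odd_amp Q t = U Q t y y - U Q t y z"

lemma odd_amp_eq: "odd_amp Q t
    = (\<Sum>v\<in>{x, y, z}. \<Sum>w\<in>{x, y, z}. of_real (odd_vec v) * U Q t w v * of_real (odd_vec w))"
proof -
  have "complex_of_real (sqrt 2) * complex_of_real (sqrt 2) = 2"
    by (simp flip: of_real_mult)
  then show ?thesis
    using distinct evol_swap[of Q t]
    by (simp only: sum_wells) (simp add: odd_vec_def odd_amp_def field_simps)
qed

lemma odd_amp_le: "cmod (odd_amp Q t) \<le> 1"
  unfolding odd_amp_eq by (rule evol_element_le) (fact odd_vec)+

text \<open>An odd \<open>f\<close> vanishes at \<open>x\<close> and has opposite values at
  \<open>y\<close> and \<open>z\<close>, so its overlap with \<open>odd_vec\<close> captures all of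
  its mass on the wells.\<close>

lemma odd_amp_phase:
  assumes "Q > 0" "eigenstate Q m f" "\<And>v. v \<in> V \<Longrightarrow> f (\<sigma> v) = - f v"
  shows "cmod (odd_amp Q t - cis (t * m)) \<le> 1 / Q + sqrt (1 / Q)"
  unfolding odd_amp_eq
proof (rule eigenstate_phase[OF assms(2) odd_vec])
  have "f x = 0" "f z = - f y" using assms(3)[of x] assms(3)[of y] in_V \<sigma> by auto
  then have "(\<Sum>v\<in>{x, y, z}. odd_vec v * f v)\<^sup>2 = (\<Sum>v\<in>{x, y, z}. (f v)\<^sup>2)"
    using distinct by (simp only: sum_wells) (simp add: odd_vec_def field_simps power2_eq_square)
  then show "1 - 1 / Q \<le> (\<Sum>v\<in>{x, y, z}. odd_vec v * f v)\<^sup>2"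
    using eigenstate_localized[OF assms(2,1)] by simp
qed

text \<open>At the ground energy, an odd state would be a minimizer with a zero at the fixed vertex
  \<open>x\<close>, hence identically zero.\<close>

lemma odd_energy_neq:
  assumes "ground_state Q l \<psi>" "eigenstate Q m f" "\<And>v. v \<in> V \<Longrightarrow> f (\<sigma> v) = - f v"
  shows "l \<noteq> m"
proof
  assume "l = m"
  have "f x = 0" using assms(3)[of x] in_V \<sigma> by auto
  have "f v = 0" if "v \<in> V" for v
    by (rule ground_energy_vanishing[where l = l and Q = Q and u = x])
      (use assms \<open>l = m\<close> \<open>f x = 0\<close> in_V that in \<open>simp_all add: ground_state_def eigenstate_def\<close>)
  then show False using assms(2) by (simp add: eigenstate_def)
qed

lemma symmetric_TC:
  assumes \<rho>: "automorphism V E \<rho>" "\<rho> x = y" "\<rho> y = x" "\<rho> z = z"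
  shows "TC V E {x, y, z} y z = ereal (4 / 9)"
proof -
  have \<rho>_wells: "\<rho> ` {x, y, z} = {x, y, z}" using \<rho> by auto
  define s where "s = (\<lambda>v. if v \<in> {x, y, z} then 1 / sqrt 3 else 0)"
  define S where "S = (\<lambda>Q t. \<Sum>v\<in>{x, y, z}. \<Sum>w\<in>{x, y, z}. of_real (s v) * U Q t w v * of_real (s w))"
  have s: "(\<Sum>v\<in>{x, y, z}. (s v)\<^sup>2) = 1" "\<And>v. v \<notin> {x, y, z} \<Longrightarrow> s v = 0"
    by (simp only: sum_wells) (simp_all add: s_def power_divide)
  have yz: "U Q t y z = (S Q t - odd_amp Q t) / 3" for Q t
  proof -
    \<comment> \<open>\<rho> and \<sigma> generate all permutations of the wells, so the evolution
      between wells has one diagonal and one off-diagonal value; \<open>S\<close> and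
      \<open>odd_amp\<close> are the two eigenvalues of this 3 by 3 block.\<close>
    have 1: "U Q t x x = U Q t y y" "U Q t y x = U Q t x y" "U Q t x z = U Q t y z" "U Q t z x = U Q t z y"
      using evol_invariant[OF \<rho>(1) \<rho>_wells, of x x Q t] evol_invariant[OF \<rho>(1) \<rho>_wells, of x y Q t]
        evol_invariant[OF \<rho>(1) \<rho>_wells, of y z Q t] evol_invariant[OF \<rho>(1) \<rho>_wells, of z y Q t] in_V \<rho>
      by auto
    have 2: "U Q t x z = U Q t x y" "U Q t z x = U Q t y x"
      using evol_invariant[OF auto_\<sigma> \<sigma>_wells, of x y Q t] evol_invariant[OF auto_\<sigma> \<sigma>_wells, of y x Q t]
        in_V \<sigma> by auto
    have "complex_of_real (sqrt 3) * complex_of_real (sqrt 3) = 3"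
      by (simp flip: of_real_mult)
    then have "S Q t = U Q t y y + 2 * U Q t y z"
      unfolding S_def using 1 2 evol_swap[of Q t]
      by (simp only: sum_wells) (simp add: s_def field_simps)
    then show ?thesis by (simp add: odd_amp_def)
  qed
  have "TC V E {x, y, z} y z = ereal ((2 / 3)\<^sup>2)"
  proof (rule TC_eqI[where \<delta> = "\<lambda>Q. 2 * (1 / Q + sqrt (1 / Q)) / 3"])
    show "cmod (U Q t y z) \<le> 2 / 3" for Q t
      using norm_triangle_ineq4[of "S Q t" "odd_amp Q t"] odd_amp_le[of Q t]
        evol_element_le[OF s(1,1) s(2,2), of Q t]
      by (simp add: yz norm_divide S_def)
    have "((\<lambda>Q::real. 2 * (1 / Q + sqrt (1 / Q)) / 3) \<longlongrightarrow> 2 * (0 + sqrt 0) / 3) at_top"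
      by (intro tendsto_intros tendsto_one_over_at_top) auto
    then show "((\<lambda>Q. 2 * (1 / Q + sqrt (1 / Q)) / 3) \<longlongrightarrow> 0) at_top" by simp
    show "\<forall>\<^sub>F Q in at_top. \<exists>t\<ge>0. 2 / 3 - 2 * (1 / Q + sqrt (1 / Q)) / 3 \<le> cmod (U Q t y z)"
      using eventually_gt_at_top[of 0]
    proof eventually_elim
      case (elim Q)
      obtain l \<psi> where \<psi>: "ground_state Q l \<psi>" using ground_state_exists[of Q] by auto
      then have \<psi>': "eigenstate Q l \<psi>" by (simp add: ground_state_def)
      obtain m f where f: "eigenstate Q m f" "\<And>v. v \<in> V \<Longrightarrow> f (\<sigma> v) = - f v"
        using odd_state_exists by blast
      \<comment> \<open>Each transposition fixes one well, the fixed vertex that invariance of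
        \<psi> relies on. As \<psi> is constant on the wells, its overlap with \<open>s\<close>
        loses none of its mass there.\<close>
      have "\<psi> y = \<psi> x" "\<psi> z = \<psi> y"
        using ground_state_invariant[OF \<psi> \<rho>(1) wells_invariant[OF \<rho>(1) \<rho>_wells], of z x]
          ground_state_invariant[OF \<psi> auto_\<sigma> wells_invariant[OF auto_\<sigma> \<sigma>_wells], of x y] in_V \<rho> \<sigma>
        by auto
      then have "(\<Sum>v\<in>{x, y, z}. s v * \<psi> v)\<^sup>2 = (\<Sum>v\<in>{x, y, z}. (\<psi> v)\<^sup>2)"
        by (simp only: sum_wells) (simp add: s_def field_simps power2_eq_square)
      then have "1 - 1 / Q \<le> (\<Sum>v\<in>{x, y, z}. s v * \<psi> v)\<^sup>2"
        using eigenstate_localized[OF \<psi>' elim] by simp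
      then have S: "cmod (S Q t - cis (t * l)) \<le> 1 / Q + sqrt (1 / Q)" for t
        unfolding S_def by (intro eigenstate_phase[OF \<psi>' s])
      obtain t where "t \<ge> 0" "2 - ((1 / Q + sqrt (1 / Q)) + (1 / Q + sqrt (1 / Q)))
          \<le> cmod (S Q t - odd_amp Q t)"
        using opposite_phases[OF odd_energy_neq[OF \<psi> f]] S odd_amp_phase[OF elim f] by metis
      then show ?case by (intro exI[of _ t]) (simp add: yz norm_divide field_simps)
    qed
  qed simp
  then show ?thesis by (simp add: power_divide)
qed

text \<open>The detuning enters through the ground state alone: once its weight at \<open>x\<close>
  tends to 0, it approaches the even combination of \<open>y\<close> and \<open>z\<close>, and the
  reflection \<sigma> suffices for the rest.\<close>

lemma detuned_TC:
  assumes small: "\<forall>\<^sub>F Q in at_top. \<forall>l \<psi>. ground_state Q l \<psi> \<longrightarrow> (\<psi> x)\<^sup>2 \<le> \<epsilon> Q"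
    and \<epsilon>: "(\<epsilon> \<longlongrightarrow> 0) at_top"
  shows "TC V E {x, y, z} y z = 1"
proof -
  define s where "s = (\<lambda>v. if v \<in> {y, z} then 1 / sqrt 2 else 0)"
  define S where "S = (\<lambda>Q t. \<Sum>v\<in>{x, y, z}. \<Sum>w\<in>{x, y, z}. of_real (s v) * U Q t w v * of_real (s w))"
  have s: "(\<Sum>v\<in>{x, y, z}. (s v)\<^sup>2) = 1" "\<And>v. v \<notin> {x, y, z} \<Longrightarrow> s v = 0"
    using distinct by (simp only: sum_wells) (simp_all add: s_def power_divide)
  have yz: "U Q t y z = (S Q t - odd_amp Q t) / 2" for Q t
  proof -
    have "complex_of_real (sqrt 2) * complex_of_real (sqrt 2) = 2"
      by (simp flip: of_real_mult)
    then have "S Q t = U Q t y y + U Q t y z"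
      unfolding S_def using evol_swap[of Q t] distinct
      by (simp only: sum_wells) (simp add: s_def field_simps)
    then show ?thesis by (simp add: odd_amp_def)
  qed
  define \<delta> where "\<delta> = (\<lambda>Q. 1 / Q + sqrt (1 / Q) + (1 / Q + \<epsilon> Q + sqrt (1 / Q + \<epsilon> Q)))"
  have "TC V E {x, y, z} y z = ereal (1\<^sup>2)"
  proof (rule TC_eqI[where \<delta> = "\<lambda>Q. \<delta> Q / 2"])
    show "cmod (U Q t y z) \<le> 1" for Q t
      using norm_triangle_ineq4[of "S Q t" "odd_amp Q t"] odd_amp_le[of Q t]
        evol_element_le[OF s(1,1) s(2,2), of Q t]
      by (simp add: yz norm_divide S_def)
    have "((\<lambda>Q. \<delta> Q / 2) \<longlongrightarrow> (0 + sqrt 0 + (0 + 0 + sqrt (0 + 0))) / 2) at_top"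
      unfolding \<delta>_def by (intro tendsto_intros \<epsilon> tendsto_one_over_at_top) auto
    then show "((\<lambda>Q. \<delta> Q / 2) \<longlongrightarrow> 0) at_top" by simp
    show "\<forall>\<^sub>F Q in at_top. \<exists>t\<ge>0. 1 - \<delta> Q / 2 \<le> cmod (U Q t y z)"
      using eventually_gt_at_top[of 0] small
    proof eventually_elim
      case (elim Q)
      obtain l \<psi> where \<psi>: "ground_state Q l \<psi>" using ground_state_exists[of Q] by auto
      then have \<psi>': "eigenstate Q l \<psi>" by (simp add: ground_state_def)
      obtain m f where f: "eigenstate Q m f" "\<And>v. v \<in> V \<Longrightarrow> f (\<sigma> v) = - f v"
        using odd_state_exists by blast
      have "\<psi> z = \<psi> y"
        using ground_state_invariant[OF \<psi> auto_\<sigma> wells_invariant[OF auto_\<sigma> \<sigma>_wells], of x y] in_V \<sigma>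
        by auto
      \<comment> \<open>By evenness, the overlap with \<open>s\<close> misses exactly the mass at
        \<open>x\<close>.\<close>
      then have "(\<Sum>v\<in>{x, y, z}. s v * \<psi> v)\<^sup>2 = (\<Sum>v\<in>{x, y, z}. (\<psi> v)\<^sup>2) - (\<psi> x)\<^sup>2"
        using distinct by (simp only: sum_wells) (simp add: s_def field_simps power2_eq_square)
      then have "1 - (1 / Q + \<epsilon> Q) \<le> (\<Sum>v\<in>{x, y, z}. s v * \<psi> v)\<^sup>2"
        using eigenstate_localized[OF \<psi>' elim(1)] elim(2) \<psi> by (smt (verit))
      then have S: "cmod (S Q t - cis (t * l)) \<le> 1 / Q + \<epsilon> Q + sqrt (1 / Q + \<epsilon> Q)" for t
        unfolding S_def by (intro eigenstate_phase[OF \<psi>' s])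
      obtain t where "t \<ge> 0" "2 - ((1 / Q + \<epsilon> Q + sqrt (1 / Q + \<epsilon> Q)) + (1 / Q + sqrt (1 / Q)))
          \<le> cmod (S Q t - odd_amp Q t)"
        using opposite_phases[OF odd_energy_neq[OF \<psi> f]] S odd_amp_phase[OF elim(1) f] by metis
      then show ?case by (intro exI[of _ t]) (simp add: yz norm_divide \<delta>_def field_simps)
    qed
  qed simp
  then show ?thesis by simp
qed

end

section \<open>The spider graph\<close>

text \<open>
  The triangle \<open>0, 1, 2\<close> with a path attached to each corner: vertex \<open>v\<close> lies on leg \<open>v mod 3\<close> at
  depth \<open>v div 3\<close>. Increasing \<open>n\<close> by one attaches the vertex \<open>n\<close> to the end of leg \<open>n mod 3\<close>.
\<close>
definition spider :: "nat \<Rightarrow> nat \<Rightarrow> nat \<Rightarrow> bool" where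
  "spider n a b \<longleftrightarrow> a < n \<and> b < n \<and> (a < 3 \<and> b < 3 \<and> a \<noteq> b \<or> a = b + 3 \<or> b = a + 3)"

lemma spider_sym: "spider n a b \<longleftrightarrow> spider n b a"
  by (auto simp: spider_def)

lemma spider_graph: "n > 0 \<Longrightarrow> graph {..<n} (spider n)"
  by (auto simp: graph_def spider_def)

lemma spider_connected:
  assumes "n \<ge> 3"
  shows "connected_graph {..<n} (spider n)"
proof -
  have from0: "(spider n)\<^sup>*\<^sup>* 0 a" if "a < n" for a
    using that
  proof (induction a rule: less_induct)
    case (less a)
    show ?case
    proof (cases "a < 3")
      case True
      then show ?thesis using assms by (cases "a = 0") (auto simp: spider_def)
    next
      case False
      then have "(spider n)\<^sup>*\<^sup>* 0 (a - 3)" using less by auto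
      moreover have "spider n (a - 3) a" using False less.prems by (auto simp: spider_def)
      ultimately show ?thesis by (rule rtranclp.rtrancl_into_rtrancl)
    qed
  qed
  have "symp (spider n)\<^sup>*\<^sup>*"
    by (intro symp_rtranclp sympI) (simp add: spider_sym)
  then have "(spider n)\<^sup>*\<^sup>* a b" if "a < n" "b < n" for a b
    using from0[OF that(1)] from0[OF that(2)] by (meson rtranclp_trans sympD)
  then show ?thesis using assms by (simp add: connected_graph_def spider_graph)
qed

text \<open>An involution is its own inverse: this gives bijectivity, and applying \<tau> twice
  turns the one-way conditions into equivalences.\<close>

lemma spider_automorphism:
  assumes "\<And>v. \<tau> (\<tau> v) = v" "\<And>v. \<tau> (v + 3) = \<tau> v + 3" "\<And>v. \<tau> v < 3 \<longleftrightarrow> v < 3" "\<And>v. v < n \<Longrightarrow> \<tau> v < n"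
  shows "automorphism {..<n} (spider n) \<tau>"
proof -
  have "\<tau> a = \<tau> b + 3 \<longleftrightarrow> a = b + 3" "\<tau> a = \<tau> b \<longleftrightarrow> a = b" for a b
    by (metis assms(1,2))+
  moreover have "\<tau> v < n \<longleftrightarrow> v < n" for v by (metis assms(1,4))
  moreover have "bij_betw \<tau> {..<n} {..<n}"
    by (rule bij_betw_byWitness[where f' = \<tau>]) (auto simp: assms)
  ultimately show ?thesis by (simp add: automorphism_def spider_def assms(3))
qed

section \<open>Symmetries permuting the legs\<close>

lemma leg_cases:
  fixes v :: nat
  obtains k where "v = 3 * k" | k where "v = 3 * k + 1" | k where "v = 3 * k + 2"
proof -
  have "v = 3 * (v div 3) \<or> v = 3 * (v div 3) + 1 \<or> v = 3 * (v div 3) + 2" by presburger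
  then show ?thesis using that by blast
qed

definition swap_legs12 :: "nat \<Rightarrow> nat" where
  "swap_legs12 v = (if v mod 3 = 1 then v + 1 else if v mod 3 = 2 then v - 1 else v)"

lemma swap_legs12_simps [simp]:
  "swap_legs12 (3 * k) = 3 * k" "swap_legs12 (3 * k + 1) = 3 * k + 2" "swap_legs12 (3 * k + 2) = 3 * k + 1"
  by (simp_all add: swap_legs12_def) presburger+

definition swap_legs01 :: "nat \<Rightarrow> nat" where
  "swap_legs01 v = (if v mod 3 = 0 then v + 1 else if v mod 3 = 1 then v - 1 else v)"

lemma swap_legs01_simps [simp]:
  "swap_legs01 (3 * k) = 3 * k + 1" "swap_legs01 (3 * k + 1) = 3 * k" "swap_legs01 (3 * k + 2) = 3 * k + 2"
  by (simp_all add: swap_legs01_def) presburger+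

text \<open>Legs 1 and 2 have equal length unless \<open>n mod 3 = 2\<close>, when the last vertex
  \<open>n - 1\<close> lies on leg 1 and its mirror image would be \<open>n\<close>.\<close>

lemma swap_legs12_automorphism:
  assumes "n mod 3 \<noteq> 2"
  shows "automorphism {..<n} (spider n) swap_legs12"
proof (rule spider_automorphism)
  fix v :: nat
  show "swap_legs12 (swap_legs12 v) = v" by (cases v rule: leg_cases) (simp_all del: One_nat_def add_2_eq_Suc')
  show "swap_legs12 (v + 3) = swap_legs12 v + 3"
    using swap_legs12_simps[of "v div 3 + 1"]
    by (cases v rule: leg_cases) (simp_all add: swap_legs12_def mod_simps, presburger+)
  show "swap_legs12 v < 3 \<longleftrightarrow> v < 3"
    by (cases v rule: leg_cases) (simp_all add: swap_legs12_def, presburger+)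
  show "swap_legs12 v < n" if "v < n"
    using assms that by (cases v rule: leg_cases) (simp_all add: swap_legs12_def, presburger+)
qed

text \<open>With \<open>n mod 3 = 0\<close> all three legs are equally long.\<close>

lemma swap_legs01_automorphism:
  assumes "n mod 3 = 0"
  shows "automorphism {..<n} (spider n) swap_legs01"
proof (rule spider_automorphism)
  fix v :: nat
  show "swap_legs01 (swap_legs01 v) = v" by (cases v rule: leg_cases) (simp_all del: One_nat_def add_2_eq_Suc')
  show "swap_legs01 (v + 3) = swap_legs01 v + 3"
    using swap_legs01_simps[of "v div 3 + 1"]
    by (cases v rule: leg_cases) (simp_all add: swap_legs01_def mod_simps, presburger+)
  show "swap_legs01 v < 3 \<longleftrightarrow> v < 3"
    by (cases v rule: leg_cases) (simp_all add: swap_legs01_def, presburger+)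
  show "swap_legs01 v < n" if "v < n"
    using assms that by (cases v rule: leg_cases) (simp_all add: swap_legs01_def, presburger+)
qed

section \<open>Degrees and the eigenvalue equation along the legs\<close>

lemma spider_nbrs:
  assumes "3 \<le> v" "v < n"
  shows "{w \<in> {..<n}. spider n v w} = (if v + 3 < n then {v - 3, v + 3} else {v - 3})"
  using assms by (auto simp: spider_def)

lemma spider_deg:
  assumes "3 \<le> v" "v < n"
  shows "deg {..<n} (spider n) v = (if v + 3 < n then 2 else 1)"
  unfolding deg_def spider_nbrs[OF assms] by auto

lemma spider_deg_pos:
  assumes "3 \<le> n" "v < n"
  shows "deg {..<n} (spider n) v > 0"
proof -
  have "(if v = 0 then 1 else if v < 3 then 0 else v - 3) \<in> {w \<in> {..<n}. spider n v w}"
    using assms by (auto simp: spider_def)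
  then show ?thesis unfolding deg_def by (subst card_gt_0_iff) auto
qed

text \<open>Division by \<open>\<surd>deg\<close> turns the eigenvalue equation into a recursion with constant coefficients off the wells.\<close>
lemma (in well_graph) eigenstate_walk:
  fixes \<psi> \<alpha> :: "nat \<Rightarrow> real" and Q l :: real
  defines "\<alpha> \<equiv> \<lambda>w. \<psi> w / sqrt (deg V E w)"
  assumes "eigenstate Q l \<psi>" "v \<in> V" and pos: "\<And>w. w \<in> V \<Longrightarrow> deg V E w > 0"
  shows "(\<Sum>w\<in>{w\<in>V. E v w}. \<alpha> w) = deg V E v * (1 - l - Q * of_bool (v \<in> Wl)) * \<alpha> v"
proof -
  define d where "d = (\<lambda>w. real (deg V E w))"
  have d: "d v > 0" using pos assms(3) by (simp add: d_def)
  have "l * \<psi> v = (\<Sum>w\<in>V. h Q v w * \<psi> w)"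
    using assms by (simp add: eigenstate_def)
  also have "\<dots> = (\<Sum>w\<in>V. (if w = v then (1 - Q * of_bool (v \<in> Wl)) * \<psi> v else 0)
      - (if E v w then \<alpha> w / sqrt (d v) else 0))"
    using graph
    by (intro sum.cong refl) (auto simp: rham_def lap_def \<alpha>_def d_def graph_def real_sqrt_mult)
  also have "\<dots> = (1 - Q * of_bool (v \<in> Wl)) * \<psi> v - (\<Sum>w\<in>{w\<in>V. E v w}. \<alpha> w) / sqrt (d v)"
    using finite_V assms(3) by (simp add: sum_subtractf sum.inter_filter sum_divide_distrib if_distrib[of "\<lambda>x. x / _"]
        cong: if_cong)
  finally have "(\<Sum>w\<in>{w\<in>V. E v w}. \<alpha> w) = sqrt (d v) * ((1 - l - Q * of_bool (v \<in> Wl)) * \<psi> v)"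
    using d by (simp add: field_simps)
  also have "\<psi> v = sqrt (d v) * \<alpha> v" using d by (simp add: \<alpha>_def d_def)
  finally show ?thesis using d by (simp add: d_def)
qed

text \<open>
  \<open>a\<close> and \<open>b\<close> are an eigenfunction along the longer and the shorter leg, both with the well at
  depth \<open>L\<close>. Their Wronskian is constant, and its value at the leaf of \<open>b\<close> is positive because of
  the different lengths; between the triangle and the wells, \<open>b k * a 0 - a k * b 0\<close> solves the
  recursion with initial slope equal to that Wronskian and so grows geometrically.
\<close>
lemma detuned_amplitude_le:
  fixes a b :: "nat \<Rightarrow> real" and \<mu> Q :: real and M :: nat
  defines "L \<equiv> 2 * M + 2" and "K \<equiv> 3 * M + 2"
  assumes M: "M \<ge> 1" and \<mu>: "\<mu> > 1"
    and pos: "\<And>k. k \<le> Suc K \<Longrightarrow> a k > 0" "\<And>k. k \<le> K \<Longrightarrow> b k > 0"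
    and a: "\<And>k. k < K \<Longrightarrow> a k + a (k + 2) = 2 * (\<mu> - Q * of_bool (k + 1 = L)) * a (k + 1)"
    and b: "\<And>k. k + 1 < K \<Longrightarrow> b k + b (k + 2) = 2 * (\<mu> - Q * of_bool (k + 1 = L)) * b (k + 1)"
    and a_end: "a K = \<mu> * a (K + 1)" and b_end: "b (K - 1) = \<mu> * b K"
  shows "a L \<le> 4 ^ M / (\<mu>\<^sup>2 - 1) * a 0"
proof -
  define W where "W = (\<lambda>k. a k * b (k + 1) - a (k + 1) * b k)"
  have W0: "W k = W 0" if "k < K" for k
    using that
  proof (induction k)
    case (Suc k)
    \<comment> \<open>Both legs have the well at the same depth, so the recursions share the
      coefficient \<open>c\<close> even across the well, and it cancels in the Wronskian.\<close>
    define c where "c = 2 * (\<mu> - Q * of_bool (k + 1 = L))"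
    have rec: "a (k + 2) = c * a (k + 1) - a k" "b (k + 2) = c * b (k + 1) - b k"
      using a[of k] b[of k] Suc.prems by (simp_all add: c_def)
    have "W (Suc k) = a (k + 1) * b (k + 2) - a (k + 2) * b (k + 1)" by (simp add: W_def)
    also have "\<dots> = W k" unfolding rec W_def by (simp add: algebra_simps)
    finally have "W (Suc k) = W k" .
    then show ?case using Suc by simp
  qed simp
  have "W (K - 1) = (\<mu>\<^sup>2 - 1) * b K * a (K + 1)"
  proof -
    \<comment> \<open>At depth \<open>K\<close> the longer leg still obeys the inner recursion,
      while the shorter one already ends. \<open>M \<ge> 1\<close> keeps this depth off the well,
      since \<open>K - L = M\<close>.\<close>
    have aK: "a (K - 1) = (2 * \<mu>\<^sup>2 - 1) * a (K + 1)"
      using a[of "K - 1"] a_end M by (simp add: K_def L_def algebra_simps power2_eq_square)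
    have "W (K - 1) = a (K - 1) * b K - a K * b (K - 1)"
      using M by (simp add: W_def K_def)
    then show ?thesis
      unfolding b_end a_end aK by (simp add: algebra_simps power2_eq_square)
  qed
  then have W: "W 0 = (\<mu>\<^sup>2 - 1) * b K * a (K + 1)"
    using W0[of "K - 1"] M by (simp add: K_def)
  have \<mu>2: "\<mu>\<^sup>2 - 1 > 0" using \<mu> by (simp add: power_strict_mono[of 1 \<mu> 2, simplified])
  have Wpos: "W 0 > 0" using W \<mu>2 pos(1)[of "Suc K"] pos(2)[of K] by simp
  define D where "D = (\<lambda>k. b k * a 0 - a k * b 0)"
  \<comment> \<open>\<open>D 0 = 0\<close> and \<open>D 1 = W 0\<close>. Carrying monotonicity along
    gives \<open>2 * \<mu> * D (k + 1) - D k \<ge> \<mu> * D (k + 1)\<close>, one factor \<mu> per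
    step.\<close>
  have D: "\<mu> ^ k * W 0 \<le> D (k + 1) \<and> D k \<le> D (k + 1) \<and> 0 \<le> D k" if "k + 1 \<le> L" for k
    using that
  proof (induction k)
    case 0
    then show ?case using Wpos by (simp add: D_def W_def mult.commute)
  next
    case (Suc k)
    have IH: "\<mu> ^ k * W 0 \<le> D (k + 1)" "D k \<le> D (k + 1)" "0 \<le> D k" using Suc by auto
    have rec: "a (k + 2) = 2 * \<mu> * a (k + 1) - a k" "b (k + 2) = 2 * \<mu> * b (k + 1) - b k"
      using a[of k] b[of k] Suc.prems M by (simp_all add: L_def K_def)
    have "D (k + 2) = 2 * \<mu> * D (k + 1) - D k" unfolding D_def rec by (simp add: algebra_simps)
    moreover have "\<mu> * D (k + 1) \<ge> 1 * D (k + 1)" using \<mu> IH by (intro mult_right_mono) auto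
    ultimately have 1: "D (k + 2) \<ge> \<mu> * D (k + 1)" using IH by linarith
    moreover have "\<mu> * D (k + 1) \<ge> \<mu> * (\<mu> ^ k * W 0)" using \<mu> IH by (intro mult_left_mono) auto
    ultimately show ?case using IH \<open>\<mu> * D (k + 1) \<ge> 1 * D (k + 1)\<close> by simp
  qed
  \<comment> \<open>Beyond the well, positivity of the next value in the recursion shows that a step
    towards the leaf costs a factor of at most \<open>2 * \<mu>\<close>.\<close>
  have aL: "a L \<le> (2 * \<mu>) ^ j * a (L + j)" if "j \<le> M" for j
    using that
  proof (induction j)
    case (Suc j)
    have "a (L + j) \<le> 2 * \<mu> * a (L + j + 1)"
      using a[of "L + j"] pos(1)[of "L + j + 2"] Suc.prems by (simp add: L_def K_def)
    then have "(2 * \<mu>) ^ j * a (L + j) \<le> (2 * \<mu>) ^ j * (2 * \<mu> * a (L + j + 1))"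
      using \<mu> by (intro mult_left_mono) auto
    then show ?case using Suc by (simp add: mult_ac)
  qed simp
  have bL: "b L \<le> (2 * \<mu>) ^ j * b (L + j)" if "j \<le> M" for j
    using that
  proof (induction j)
    case (Suc j)
    have "b (L + j) \<le> 2 * \<mu> * b (L + j + 1)"
    proof (cases "L + j + 1 < K")
      case True
      then show ?thesis
        using b[of "L + j"] pos(2)[of "L + j + 2"] by (simp add: L_def K_def)
    next
      \<comment> \<open>The final step of the shorter leg uses the leaf condition in place of the
        recursion.\<close>
      case False
      then have "L + j + 1 = K" using Suc.prems by (simp add: L_def K_def)
      then have "b (L + j) = \<mu> * b K" using b_end by (metis add_diff_cancel_right')
      then show ?thesis using \<open>L + j + 1 = K\<close> \<mu> pos(2)[of K] by simp
    qed
    then have "(2 * \<mu>) ^ j * b (L + j) \<le> (2 * \<mu>) ^ j * (2 * \<mu> * b (L + j + 1))"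
      using \<mu> by (intro mult_left_mono) auto
    then show ?case using Suc by (simp add: mult_ac)
  qed simp
  have LM: "L + M = K" by (simp add: L_def K_def)
  define P where "P = (2 * \<mu>) ^ M"
  have P: "P > 0" "P * P = 4 ^ M * \<mu> ^ (2 * M)"
    using \<mu> by (simp_all add: P_def power_mult_distrib power_mult power2_eq_square)
      (simp add: mult_ac flip: power_mult_distrib)
  have aL': "a L \<le> P * \<mu> * a (K + 1)" and bL': "b L \<le> P * b K"
    using aL[of M] bL[of M] a_end by (simp_all add: LM P_def)
  have L0: "a L > 0" "b L > 0" "b 0 > 0" using pos by (auto simp: L_def K_def)
  \<comment> \<open>This is the lower bound on \<open>D L\<close> with the positive term
    \<open>a L * b 0\<close> dropped; the exponent is \<open>L - 1\<close>. Replacing the leaf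
    values by well values costs \<open>P * P * \<mu>\<close>, which contains the same power of
    \<mu>, so these powers cancel and only \<open>4 ^ M / (\<mu>\<^sup>2 - 1)\<close>
    remains.\<close>
  have "\<mu> ^ (2 * M + 1) * ((\<mu>\<^sup>2 - 1) * b K * a (K + 1)) \<le> b L * a 0"
    using D[of "2 * M + 1"] W mult_pos_pos[OF L0(1) L0(3)] by (simp add: L_def D_def)
  then have "P * \<mu> * P * (\<mu> ^ (2 * M + 1) * ((\<mu>\<^sup>2 - 1) * b K * a (K + 1))) \<le> P * \<mu> * P * (b L * a 0)"
    using P \<mu> by (intro mult_left_mono) auto
  moreover have "\<mu> ^ (2 * M + 1) * (\<mu>\<^sup>2 - 1) * (b L * a L)
      \<le> \<mu> ^ (2 * M + 1) * (\<mu>\<^sup>2 - 1) * ((P * b K) * (P * \<mu> * a (K + 1)))"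
    using aL' bL' L0 \<mu> \<mu>2 P pos(2)[of K] by (intro mult_left_mono mult_mono) auto
  ultimately have "\<mu> ^ (2 * M + 1) * (\<mu>\<^sup>2 - 1) * (b L * a L) \<le> P * P * \<mu> * (b L * a 0)"
    by (simp add: mult_ac)
  also have "\<dots> = \<mu> ^ (2 * M + 1) * (4 ^ M * b L * a 0)"
    unfolding P(2) by simp
  finally have "(\<mu>\<^sup>2 - 1) * (b L * a L) \<le> 4 ^ M * b L * a 0"
    using \<mu> by (simp add: mult.assoc del: power_Suc)
  then have "b L * ((\<mu>\<^sup>2 - 1) * a L) \<le> b L * (4 ^ M * a 0)" by (simp add: mult_ac)
  then have "(\<mu>\<^sup>2 - 1) * a L \<le> 4 ^ M * a 0" using L0 by simp
  then show ?thesis using \<mu>2 by (simp add: field_simps)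
qed

section \<open>The spider with one longer leg\<close>

lemma spider_triple_well:
  assumes "R \<ge> 1" "9 * R + 9 \<le> n" "n mod 3 \<noteq> 2"
  shows "triple_well {..<n} (spider n) (6 * R + 6) (6 * R + 7) (6 * R + 8) swap_legs12"
proof
  show "connected_graph {..<n} (spider n)" using assms by (intro spider_connected) simp
  show "automorphism {..<n} (spider n) swap_legs12"
    by (rule swap_legs12_automorphism) fact
  show "swap_legs12 (6 * R + 6) = 6 * R + 6" "swap_legs12 (6 * R + 7) = 6 * R + 8"
    "swap_legs12 (6 * R + 8) = 6 * R + 7"
    using swap_legs12_simps[of "2 * R + 2"] by (simp_all add: add.commute)
qed (use assms in \<open>auto simp: spider_def\<close>)

text \<open>The wells lie at depth \<open>2 * R + 2\<close>; legs 1 and 2 end at depth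
  \<open>3 * R + 2\<close> and leg 0 one step later. The recursion estimate applies with
  \<open>M = R\<close> to legs 0 and 1. The factor 2 is the degree at the well, undoing the
  normalization in \<alpha>.\<close>

lemma detuned_ground_state:
  fixes R :: nat and Q :: real
  defines "n \<equiv> Suc (9 * R + 9)" and "W \<equiv> {6 * R + 6, 6 * R + 7, 6 * R + 8}"
  assumes R: "R \<ge> 1" and Q: "Q > 1" and \<psi>: "well_graph.ground_state {..<n} (spider n) W Q l \<psi>"
  shows "(\<psi> (6 * R + 6))\<^sup>2 \<le> 2 * (4 ^ R / (Q\<^sup>2 - 1))\<^sup>2"
proof -
  have "n mod 3 \<noteq> 2" unfolding n_def by presburger
  then interpret triple_well "{..<n}" "spider n" "6 * R + 6" "6 * R + 7" "6 * R + 8" swap_legs12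
    using R by (intro spider_triple_well) (simp_all add: n_def)
  have gs: "eigenstate Q l \<psi>" "\<And>v. v < n \<Longrightarrow> \<psi> v > 0"
    using \<psi> by (simp_all add: W_def ground_state_def)
  define \<alpha> where "\<alpha> = (\<lambda>v. \<psi> v / sqrt (deg {..<n} (spider n) v))"
  define \<mu> where "\<mu> = 1 - l"
  have deg_pos: "deg {..<n} (spider n) v > 0" if "v < n" for v
    using that by (intro spider_deg_pos) (simp_all add: n_def)
  have \<alpha>_pos: "\<alpha> v > 0" if "v < n" for v
    using that deg_pos gs by (simp add: \<alpha>_def)
  have walk: "(\<Sum>w\<in>{w\<in>{..<n}. spider n v w}. \<alpha> w)
      = deg {..<n} (spider n) v * (\<mu> - Q * of_bool (v \<in> W)) * \<alpha> v" if "v < n" for v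
    using eigenstate_walk[OF gs(1), of v] deg_pos that by (simp add: \<alpha>_def \<mu>_def W_def)
  have inner: "\<alpha> v + \<alpha> (v + 6) = 2 * (\<mu> - Q * of_bool (v + 3 \<in> W)) * \<alpha> (v + 3)" if "v + 6 < n" for v
    using walk[of "v + 3"] that spider_nbrs[of "v + 3" n] spider_deg[of "v + 3" n]
    by (simp add: add.commute[of v])
  have leaf: "\<alpha> v = \<mu> * \<alpha> (v + 3)" if "v + 3 < n" "v + 6 \<ge> n" for v
  proof -
    have "v + 3 \<notin> W" using that R by (auto simp: W_def n_def)
    then show ?thesis
      using walk[of "v + 3"] that spider_nbrs[of "v + 3" n] spider_deg[of "v + 3" n] by simp
  qed
  have W_iff: "3 * k + 3 \<in> W \<longleftrightarrow> k + 1 = 2 * R + 2" "3 * k + 1 + 3 \<in> W \<longleftrightarrow> k + 1 = 2 * R + 2" for k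
    unfolding W_def by simp_all presburger+
  have idx: "3 * (k + 2) = 3 * k + 6" "3 * (k + 1) = 3 * k + 3"
    "3 * k + 6 + 1 = 3 * k + 1 + 6" "3 * k + 3 + 1 = 3 * k + 1 + 3" for k :: nat
    by simp_all
  have \<mu>: "\<mu> \<ge> Q" using gs by (simp add: \<mu>_def eigenstate_def)
  have Q2: "0 < Q\<^sup>2 - 1" "Q\<^sup>2 - 1 \<le> \<mu>\<^sup>2 - 1"
    using Q \<mu> by (simp_all add: power_mono one_less_power)
  have "\<alpha> (3 * (2 * R + 2)) \<le> 4 ^ R / (\<mu>\<^sup>2 - 1) * \<alpha> (3 * 0)"
  proof (rule detuned_amplitude_le[where a = "\<lambda>k. \<alpha> (3 * k)" and b = "\<lambda>k. \<alpha> (3 * k + 1)" and Q = Q])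
    show "\<alpha> (3 * k) + \<alpha> (3 * (k + 2)) = 2 * (\<mu> - Q * of_bool (k + 1 = 2 * R + 2)) * \<alpha> (3 * (k + 1))"
      if "k < 3 * R + 2" for k
      using inner[of "3 * k"] that unfolding idx W_iff by (simp add: n_def)
    show "\<alpha> (3 * k + 1) + \<alpha> (3 * (k + 2) + 1)
        = 2 * (\<mu> - Q * of_bool (k + 1 = 2 * R + 2)) * \<alpha> (3 * (k + 1) + 1)"
      if "k + 1 < 3 * R + 2" for k
      using inner[of "3 * k + 1"] that unfolding idx W_iff by (simp add: n_def)
    show "\<alpha> (3 * (3 * R + 2)) = \<mu> * \<alpha> (3 * (3 * R + 2 + 1))"
      using leaf[of "9 * R + 6"] by (simp add: n_def algebra_simps)
    show "\<alpha> (3 * (3 * R + 2 - 1) + 1) = \<mu> * \<alpha> (3 * (3 * R + 2) + 1)"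
      using leaf[of "9 * R + 4"] by (simp add: n_def algebra_simps)
  qed (use R \<mu> Q in \<open>auto intro!: \<alpha>_pos simp: n_def\<close>)
  also have "\<dots> \<le> 4 ^ R / (\<mu>\<^sup>2 - 1) * 1"
  proof (rule mult_left_mono)
    \<comment> \<open>At the triangle a crude bound is enough: \<psi> is normalized and the degree
      is at least 1.\<close>
    have "(\<psi> 0)\<^sup>2 \<le> (\<Sum>v<n. (\<psi> v)\<^sup>2)"
      by (rule member_le_sum) (auto simp: n_def)
    then have "\<psi> 0 \<le> 1" using gs(1) by (simp add: eigenstate_def abs_square_le_1)
    moreover have "1 \<le> sqrt (deg {..<n} (spider n) 0)" using deg_pos[of 0] by (simp add: n_def)
    ultimately have "\<psi> 0 \<le> sqrt (deg {..<n} (spider n) 0)" by linarith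
    then show "\<alpha> (3 * 0) \<le> 1" using deg_pos[of 0] by (simp add: \<alpha>_def n_def)
  qed (use Q2 in simp)
  also have "\<dots> \<le> 4 ^ R / (Q\<^sup>2 - 1)" using Q2 by (simp add: frac_le)
  finally have "\<alpha> (6 * R + 6) \<le> 4 ^ R / (Q\<^sup>2 - 1)" by (simp add: add.commute)
  then have "(\<alpha> (6 * R + 6))\<^sup>2 \<le> (4 ^ R / (Q\<^sup>2 - 1))\<^sup>2"
    using \<alpha>_pos[of "6 * R + 6"] by (intro power_mono) (simp_all add: n_def)
  moreover have "deg {..<n} (spider n) (6 * R + 6) = 2"
    using R by (subst spider_deg) (simp_all add: n_def)
  ultimately show ?thesis by (simp add: \<alpha>_def power_divide mult.commute)
qed

section \<open>Walks and balls around the wells\<close>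

lemma spider_relpowp_le:
  assumes "(spider n ^^ k) s v"
  shows "v \<le> s + 3 * k"
  using assms
proof (induction k arbitrary: v)
  case (Suc k)
  then obtain w where "(spider n ^^ k) s w" "spider n w v" by auto
  then have "w \<le> s + 3 * k" using Suc.IH by simp
  moreover have "v \<le> w + 3" using \<open>spider n w v\<close> by (auto simp: spider_def)
  ultimately show ?case by simp
qed simp

text \<open>A step raises the label by at most 3, so a walk of length \<open>k\<close> from
  \<open>s\<close> stays below \<open>n\<close> and cannot reach the new vertex.\<close>

lemma spider_relpowp_Suc:
  assumes "s + 3 * k < n"
  shows "(spider (Suc n) ^^ k) s v \<longleftrightarrow> (spider n ^^ k) s v"
  using assms
proof (induction k arbitrary: v)
  case (Suc k)
  have "spider (Suc n) w v \<longleftrightarrow> spider n w v" if "(spider n ^^ k) s w" for w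
    using spider_relpowp_le[OF that] Suc.prems by (auto simp: spider_def)
  moreover have "(spider (Suc n) ^^ k) s w \<longleftrightarrow> (spider n ^^ k) s w" for w
    using Suc by simp
  ultimately show ?case by (auto simp: relcompp_apply)
qed simp

theorem theorem4:
  fixes R :: nat
  assumes "R \<ge> 1"
  shows "\<exists>V E V' E' p q x y z.
     connected_graph V E \<and> connected_graph V' E' \<and>
     p \<notin> V \<and> q \<in> V \<and> V' = insert p V \<and>
     (\<forall>a b. E' a b \<longleftrightarrow> E a b \<or> (a = p \<and> b = q) \<or> (a = q \<and> b = p)) \<and>
     x \<in> V \<and> y \<in> V \<and> z \<in> V \<and> x \<noteq> y \<and> y \<noteq> z \<and> x \<noteq> z \<and>
     gball V E R {x, y, z} = gball V' E' R {x, y, z} \<and>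
     (\<forall>a\<in>gball V E R {x, y, z}. \<forall>b\<in>gball V E R {x, y, z}. E a b \<longleftrightarrow> E' a b) \<and>
     TC V E {x, y, z} y z = ereal (4/9) \<and>
     TC V' E' {x, y, z} y z = 1"
proof -
  \<comment> \<open>The largest label within \<open>R\<close> steps of a well is
    \<open>(6 * R + 8) + 3 * R = n - 1\<close>, so the balls just reach the ends of the legs and
    miss the new vertex. The corners of the triangle are \<open>2 * R + 2\<close> steps from the
    wells, far enough for the amplitude estimate. As \<open>n mod 3 = 0\<close>, the new vertex
    \<open>n\<close> extends the leg of the first well.\<close>
  define n where "n = 9 * R + 9"
  let ?x = "6 * R + 6" and ?y = "6 * R + 7" and ?z = "6 * R + 8"
  have n3: "n mod 3 = 0" "Suc n mod 3 \<noteq> 2" unfolding n_def by presburger+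
  interpret G: triple_well "{..<n}" "spider n" ?x ?y ?z swap_legs12
    using assms n3 by (intro spider_triple_well) (simp_all add: n_def)
  interpret G': triple_well "{..<Suc n}" "spider (Suc n)" ?x ?y ?z swap_legs12
    using assms n3 by (intro spider_triple_well) (simp_all add: n_def)
  have ball: "gball {..<Suc n} (spider (Suc n)) R {?x, ?y, ?z} = gball {..<n} (spider n) R {?x, ?y, ?z}"
  proof -
    have "(spider (Suc n) ^^ k) s v \<longleftrightarrow> (spider n ^^ k) s v"
      if "s \<in> {?x, ?y, ?z}" "k \<le> R" for s k v
      using that by (intro spider_relpowp_Suc) (auto simp: n_def)
    moreover have "v < n" if "s \<in> {?x, ?y, ?z}" "k \<le> R" "(spider n ^^ k) s v" for s k v
      using that spider_relpowp_le[OF that(3)] by (auto simp: n_def)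
    ultimately show ?thesis
      unfolding gball_def by (intro Collect_cong) (metis lessThan_iff less_SucI)
  qed
  have TC: "TC {..<n} (spider n) {?x, ?y, ?z} ?y ?z = ereal (4 / 9)"
  proof (rule G.symmetric_TC)
    show "automorphism {..<n} (spider n) swap_legs01"
      by (rule swap_legs01_automorphism) fact
    show "swap_legs01 ?x = ?y" "swap_legs01 ?y = ?x" "swap_legs01 ?z = ?z"
      using swap_legs01_simps[of "2 * R + 2"] by (simp_all add: add.commute)
  qed
  have TC': "TC {..<Suc n} (spider (Suc n)) {?x, ?y, ?z} ?y ?z = 1"
  proof (rule G'.detuned_TC[where \<epsilon> = "\<lambda>Q. 2 * (4 ^ R / (Q\<^sup>2 - 1))\<^sup>2"])
    have "(\<psi> ?x)\<^sup>2 \<le> 2 * (4 ^ R / (Q\<^sup>2 - 1))\<^sup>2" if "G'.ground_state Q l \<psi>" "Q > 1" for Q l \<psi>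
      by (rule detuned_ground_state[OF assms that(2) that(1)[unfolded n_def]])
    then show "\<forall>\<^sub>F Q in at_top. \<forall>l \<psi>. G'.ground_state Q l \<psi> \<longrightarrow> (\<psi> ?x)\<^sup>2 \<le> 2 * (4 ^ R / (Q\<^sup>2 - 1))\<^sup>2"
      by (intro eventually_mono[OF eventually_gt_at_top[of 1]]) blast
    have "filterlim (\<lambda>Q::real. Q\<^sup>2 - 1) at_top at_top"
      using filterlim_tendsto_add_at_top[OF tendsto_const[of "- 1"]
          filterlim_pow_at_top[of 2, OF _ filterlim_ident]] by simp
    then have "((\<lambda>Q::real. 4 ^ R / (Q\<^sup>2 - 1)) \<longlongrightarrow> 0) at_top"
      by (intro tendsto_divide_0[OF tendsto_const] filterlim_at_top_imp_at_infinity)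
    then have "((\<lambda>Q::real. 2 * (4 ^ R / (Q\<^sup>2 - 1))\<^sup>2) \<longlongrightarrow> 2 * 0\<^sup>2) at_top"
      by (intro tendsto_intros)
    then show "((\<lambda>Q::real. 2 * (4 ^ R / (Q\<^sup>2 - 1))\<^sup>2) \<longlongrightarrow> 0) at_top" by simp
  qed
  show ?thesis
  proof (intro exI conjI allI ballI)
    show "connected_graph {..<n} (spider n)" by (rule G.conn)
    show "connected_graph {..<Suc n} (spider (Suc n))" by (rule G'.conn)
    show "n \<notin> {..<n}" "{..<Suc n} = insert n {..<n}" by auto
    show "n - 3 \<in> {..<n}" by (simp add: n_def)
    show "spider (Suc n) a b \<longleftrightarrow> spider n a b \<or> (a = n \<and> b = n - 3) \<or> (a = n - 3 \<and> b = n)" for a b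
      by (auto simp: spider_def n_def)
    show "?x \<in> {..<n}" "?y \<in> {..<n}" "?z \<in> {..<n}" by (rule G.in_V)+
    show "?x \<noteq> ?y" "?y \<noteq> ?z" "?x \<noteq> ?z" by simp_all
    show "gball {..<n} (spider n) R {?x, ?y, ?z} = gball {..<Suc n} (spider (Suc n)) R {?x, ?y, ?z}"
      by (rule ball[symmetric])
    show "spider n a b \<longleftrightarrow> spider (Suc n) a b"
      if "a \<in> gball {..<n} (spider n) R {?x, ?y, ?z}" "b \<in> gball {..<n} (spider n) R {?x, ?y, ?z}" for a b
      using that by (auto simp: gball_def spider_def)
  qed (rule TC TC')+
qed

end
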